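(* Let $X$ be the intersection of finitely many pairwise distinct closed polynomial half planes (not necessarily connected or simply connected). Then there exists a cell decomposition of $X$ such that every shortest-length curve between two points of $X$ interacts with each cell at most finitely many times.
   Context: For a real polynomial $p$ and angle $\theta$, $\Phi_{p,\theta}(x,y)=p(x\cos\theta+y\sin\theta)-(-x\sin\theta+y\cos\theta)$; a closed polynomial half plane is a set $\{\Phi_{p,\theta}\ge0\}$. A shortest-length curve between $A$ and $B$ in $X$ is a continuous piecewise $C^2$ curve in $X$ from $A$ to $B$ of minimal length $\int|\gamma'|$ among all piecewise $C^2$ curves in $X$ from $A$ to $B$. A cell decomposition of $X$ is a partition of $X$ into at most countably many pairwise disjoint cells, each homeomorphic to $\mathbb{R}^d$, $d\in\{0,1,2\}$. A curve $\gamma$ interacts with a set $e$ at most $N$ times if $\gamma^{-1}(e)$ has at most $N$ connected components. *)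

theory Defs
  imports "HOL-Analysis.Analysis" "HOL-Computational_Algebra.Polynomial"
begin

text \<open>Points of the plane are pairs of reals; the norm on real \<times> real is Euclidean.\<close>

definition Phi :: "real poly \<Rightarrow> real \<Rightarrow> real \<times> real \<Rightarrow> real" where
  "Phi p \<theta> z = poly p (fst z * cos \<theta> + snd z * sin \<theta>) - (- fst z * sin \<theta> + snd z * cos \<theta>)"

definition closed_poly_halfplane :: "(real \<times> real) set \<Rightarrow> bool" where
  "closed_poly_halfplane S \<longleftrightarrow> (\<exists>p \<theta>. S = {z. Phi p \<theta> z \<ge> 0})"

definition C2_on_interval :: "(real \<Rightarrow> real \<times> real) \<Rightarrow> real \<Rightarrow> real \<Rightarrow> bool" where
  "C2_on_interval g a b \<longleftrightarrow>
     (\<exists>g1 g2. (\<forall>t\<in>{a..b}. (g has_vector_derivative g1 t) (at t within {a..b})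
                         \<and> (g1 has_vector_derivative g2 t) (at t within {a..b}))
            \<and> continuous_on {a..b} g2)"

definition piecewise_C2 :: "(real \<Rightarrow> real \<times> real) \<Rightarrow> bool" where
  "piecewise_C2 g \<longleftrightarrow> continuous_on {0..1} g \<and>
     (\<exists>S. finite S \<and> S \<subseteq> {0..1} \<and> 0 \<in> S \<and> 1 \<in> S \<and>
        (\<forall>a\<in>S. \<forall>b\<in>S. a < b \<and> {a<..<b} \<inter> S = {} \<longrightarrow> C2_on_interval g a b))"

definition curve_length :: "(real \<Rightarrow> real \<times> real) \<Rightarrow> real" where
  "curve_length g = integral {0..1} (\<lambda>t. norm (vector_derivative g (at t)))"

definition admissible_curve :: "(real \<times> real) set \<Rightarrow> real \<times> real \<Rightarrow> real \<times> real \<Rightarrow> (real \<Rightarrow> real \<times> real) \<Rightarrow> bool" where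
  "admissible_curve X A B g \<longleftrightarrow> piecewise_C2 g \<and> g ` {0..1} \<subseteq> X \<and> g 0 = A \<and> g 1 = B"

definition shortest_curve :: "(real \<times> real) set \<Rightarrow> real \<times> real \<Rightarrow> real \<times> real \<Rightarrow> (real \<Rightarrow> real \<times> real) \<Rightarrow> bool" where
  "shortest_curve X A B g \<longleftrightarrow> admissible_curve X A B g \<and>
     (\<forall>h. admissible_curve X A B h \<longrightarrow> curve_length g \<le> curve_length h)"

definition is_cell :: "(real \<times> real) set \<Rightarrow> bool" where
  "is_cell e \<longleftrightarrow> (\<exists>a. e = {a}) \<or> e homeomorphic (UNIV :: real set)
                 \<or> e homeomorphic (UNIV :: (real \<times> real) set)"

definition cell_decomposition :: "(real \<times> real) set \<Rightarrow> (real \<times> real) set set \<Rightarrow> bool" where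
  "cell_decomposition X C \<longleftrightarrow> countable C \<and> \<Union>C = X \<and> (\<forall>e\<in>C. is_cell e)
     \<and> (\<forall>e1\<in>C. \<forall>e2\<in>C. e1 \<noteq> e2 \<longrightarrow> e1 \<inter> e2 = {})"

definition interacts_finitely :: "(real \<Rightarrow> real \<times> real) \<Rightarrow> (real \<times> real) set \<Rightarrow> bool" where
  "interacts_finitely g e \<longleftrightarrow> finite (components {t \<in> {0..1}. g t \<in> e})"

end

theory Submission
  imports Defs
begin

text \<open>
  A shortest curve follows the chord between two of its points whenever the chord lies in \<open>X\<close>; so
  it meets a convex cell in one interval. The interior of \<open>X\<close> is cut into convex dyadic cells. The
  boundary consists of arcs of finitely many polynomial graphs; pairwise intersections and inflection
  points become point cells, and the rest is cut into arcs that stay away from these points, which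
  requires infinitely many cells but no analysis at the exceptional points. Near such an arc some
  defining function \<open>\<psi>\<close> of the graph is strictly quasiconcave. An excursion of a shortest
  curve to \<open>\<psi> < 0\<close> is impossible, because the curve is locally straight at a minimum of \<open>\<psi>\<close>; and if
  it reaches \<open>\<psi> > 0\<close>, then \<open>X\<close> contains the chord between any two nearby points of the graph, so the
  graph is touched at most twice. Compactness then bounds the number of components.
\<close>

section \<open>Length of piecewise C2 curves\<close>

text \<open>The decomposition is fixed before the curve, so each cell has to serve all shortest
  curves at once, and the chord property is the only fact about their shape that is ever derived. No
  regularity at contacts with the boundary is proved; the argument merely compares three contact
  times in a small convex neighbourhood. Finiteness is asked for each cell separately. A curve
  running into an exceptional point might therefore pass infinitely many arcs, as long as it meets
  each of them finitely often; this is why every arc is chosen with its closure away from the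
  exceptional points. Different half planes may share a boundary curve and lie on opposite sides of
  it, as ordinate \<le> p and ordinate \<ge> p do, and then \<open>X\<close> has no interior near
  that curve. Hence no step may presuppose which side of an arc belongs to \<open>X\<close>. What is
  used instead is that near an arc \<open>X\<close> contains all or nothing of the convex
  side.\<close>

lemma C2_on_interval_subset:
  assumes "C2_on_interval g a b" "{c..d} \<subseteq> {a..b}"
  shows "C2_on_interval g c d"
proof -
  obtain g1 g2 where "\<forall>t\<in>{a..b}. (g has_vector_derivative g1 t) (at t within {a..b})
                         \<and> (g1 has_vector_derivative g2 t) (at t within {a..b})"
    and "continuous_on {a..b} g2"
    using assms(1) unfolding C2_on_interval_def by blast
  with assms(2) show ?thesis
    unfolding C2_on_interval_def
    by - (rule exI[of _ g1], rule exI[of _ g2],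
      blast intro: has_vector_derivative_within_subset continuous_on_subset)
qed

lemma C2_on_interval_cong:
  assumes "C2_on_interval g a b" "\<And>t. t \<in> {a..b} \<Longrightarrow> g t = h t"
  shows "C2_on_interval h a b"
proof -
  obtain g1 g2 where "\<forall>t\<in>{a..b}. (g has_vector_derivative g1 t) (at t within {a..b})
                         \<and> (g1 has_vector_derivative g2 t) (at t within {a..b})"
    and "continuous_on {a..b} g2"
    using assms(1) unfolding C2_on_interval_def by blast
  moreover have "(h has_vector_derivative g1 t) (at t within {a..b})"
    if "t \<in> {a..b}" "(g has_vector_derivative g1 t) (at t within {a..b})" for t
    using that assms(2) by (intro has_vector_derivative_transform[of t "{a..b}" h g "g1 t"]) auto
  ultimately show ?thesis
    unfolding C2_on_interval_def by - (rule exI[of _ g1], rule exI[of _ g2], blast)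
qed

text \<open>Testing all intervals without inner break points, not only those between neighbouring
  ones, makes the condition monotone in \<open>S\<close>. Further break points can then be added
  freely, as splicing requires.\<close>

lemma piecewise_C2_iff:
  "piecewise_C2 g \<longleftrightarrow> continuous_on {0..1} g \<and>
     (\<exists>S. finite S \<and> (\<forall>a b. 0 \<le> a \<and> a < b \<and> b \<le> 1 \<and> {a<..<b} \<inter> S = {} \<longrightarrow> C2_on_interval g a b))"
    (is "?L \<longleftrightarrow> ?R")
proof
  assume ?L
  then obtain S where S: "finite S" "S \<subseteq> {0..1}" "0 \<in> S" "1 \<in> S"
    and C2: "\<forall>a\<in>S. \<forall>b\<in>S. a < b \<and> {a<..<b} \<inter> S = {} \<longrightarrow> C2_on_interval g a b"
    and cont: "continuous_on {0..1} g"
    unfolding piecewise_C2_def by blast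
  have "C2_on_interval g a b" if ab: "0 \<le> a" "a < b" "b \<le> 1" "{a<..<b} \<inter> S = {}" for a b
  proof -
    define a' where "a' = Max {x\<in>S. x \<le> a}"
    define b' where "b' = Min {x\<in>S. b \<le> x}"
    have a': "a' \<in> {x\<in>S. x \<le> a}"
      unfolding a'_def using S ab by (intro Max_in) auto
    have b': "b' \<in> {x\<in>S. b \<le> x}"
      unfolding b'_def using S ab by (intro Min_in) auto
    have le: "x \<le> a'" if "x \<in> S" "x \<le> a" for x
      unfolding a'_def using S that by (intro Max_ge) auto
    have ge: "b' \<le> x" if "x \<in> S" "b \<le> x" for x
      unfolding b'_def using S that by (intro Min_le) auto
    have "{a'<..<b'} \<inter> S = {}"
    proof (rule ccontr)
      assume "{a'<..<b'} \<inter> S \<noteq> {}"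
      then obtain x where x: "a' < x" "x < b'" "x \<in> S" by auto
      with le ge have "a < x" "x < b" by force+
      with x ab show False by auto
    qed
    with a' b' ab C2 have "C2_on_interval g a' b'" by auto
    then show ?thesis
      by (rule C2_on_interval_subset) (use a' b' in auto)
  qed
  with S cont show ?R by blast
next
  assume ?R
  then obtain S where S: "finite S"
    and C2: "\<And>a b. 0 \<le> a \<Longrightarrow> a < b \<Longrightarrow> b \<le> 1 \<Longrightarrow> {a<..<b} \<inter> S = {} \<Longrightarrow> C2_on_interval g a b"
    and cont: "continuous_on {0..1} g"
    by blast
  show ?L
    unfolding piecewise_C2_def
  proof (intro conjI exI[of _ "S \<inter> {0..1} \<union> {0,1}"] ballI impI cont)
    fix a b assume "a \<in> S \<inter> {0..1} \<union> {0,1}" "b \<in> S \<inter> {0..1} \<union> {0,1}"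
      and "a < b \<and> {a<..<b} \<inter> (S \<inter> {0..1} \<union> {0,1}) = {}"
    then show "C2_on_interval g a b"
      by (intro C2) auto
  qed (use S in auto)
qed

lemma C2_on_interval_imp_vector_derivative:
  assumes "C2_on_interval g a b"
  obtains g1 where "continuous_on {a..b} g1"
    and "\<And>t. t \<in> {a<..<b} \<Longrightarrow> (g has_vector_derivative g1 t) (at t)"
proof -
  obtain g1 g2 where g: "\<forall>t\<in>{a..b}. (g has_vector_derivative g1 t) (at t within {a..b})
                         \<and> (g1 has_vector_derivative g2 t) (at t within {a..b})"
    using assms(1) unfolding C2_on_interval_def by blast
  show ?thesis
  proof
    show "continuous_on {a..b} g1"
      using g has_vector_derivative_continuous by (force simp: continuous_on_eq_continuous_within)
    show "(g has_vector_derivative g1 t) (at t)" if "t \<in> {a<..<b}" for t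
    proof -
      have "at t within {a..b} = at t"
        using that by (intro at_within_interior) auto
      moreover have "t \<in> {a..b}" using that by auto
      ultimately show ?thesis using g by metis
    qed
  qed
qed

lemma piecewise_C2_has_vector_derivative:
  assumes "piecewise_C2 g"
  obtains S where "finite S"
    and "\<And>t. t \<in> {0..1} - S \<Longrightarrow> (g has_vector_derivative vector_derivative g (at t)) (at t)"
proof -
  obtain S where S: "finite S"
    and C2: "\<And>a b. 0 \<le> a \<Longrightarrow> a < b \<Longrightarrow> b \<le> 1 \<Longrightarrow> {a<..<b} \<inter> S = {} \<Longrightarrow> C2_on_interval g a b"
    using assms unfolding piecewise_C2_iff by blast
  show ?thesis
  proof
    \<comment> \<open>The ends count as exceptional: \<open>at t\<close> is two-sided, and nothing
      is known about \<open>g\<close> outside the unit interval.\<close>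
    show "finite (S \<union> {0,1})" using S by simp
    fix t :: real assume t: "t \<in> {0..1} - (S \<union> {0,1})"
    moreover have "open ({0<..<1} - S)"
      using S by (simp add: finite_imp_closed open_Diff)
    ultimately obtain e where e: "e > 0" "cball t e \<subseteq> {0<..<1} - S"
      unfolding open_contains_cball by (metis Diff_iff Un_iff atLeastAtMost_iff
          greaterThanLessThan_iff insertCI less_eq_real_def)
    have sub: "{t-e..t+e} \<subseteq> {0<..<1} - S"
      using e(2) by (simp add: cball_eq_atLeastAtMost)
    have "C2_on_interval g (t-e) (t+e)"
    proof (rule C2)
      have "t-e \<in> {t-e..t+e}" "t+e \<in> {t-e..t+e}" using e by auto
      then have "t-e \<in> {0<..<1}" "t+e \<in> {0<..<1}" using sub by blast+
      then show "0 \<le> t - e" "t + e \<le> 1" by auto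
      have "{t - e<..<t + e} \<subseteq> {t - e..t + e}" by auto
      then show "{t - e<..<t + e} \<inter> S = {}" using sub by blast
    qed (use e in auto)
    then obtain g1 where "\<And>u. u \<in> {t-e<..<t+e} \<Longrightarrow> (g has_vector_derivative g1 u) (at u)"
      using C2_on_interval_imp_vector_derivative by metis
    from this[of t] e show "(g has_vector_derivative vector_derivative g (at t)) (at t)"
      by (simp add: vector_derivative_at)
  qed
qed

lemma piecewise_C2_speed_integrable:
  assumes "piecewise_C2 g"
  shows "(\<lambda>t. norm (vector_derivative g (at t))) integrable_on {0..1}"
proof -
  let ?f = "\<lambda>t. norm (vector_derivative g (at t))"
  obtain S where S: "finite S" "S \<subseteq> {0..1}" "0 \<in> S" "1 \<in> S"
    and C2: "\<forall>a\<in>S. \<forall>b\<in>S. a < b \<and> {a<..<b} \<inter> S = {} \<longrightarrow> C2_on_interval g a b"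
    using assms unfolding piecewise_C2_def by blast
  have piece: "?f integrable_on {a..b}" if C2: "C2_on_interval g a b" for a b
  proof -
    obtain g1 where cont: "continuous_on {a..b} g1"
      and g1: "\<And>t. t \<in> {a<..<b} \<Longrightarrow> (g has_vector_derivative g1 t) (at t)"
      using C2_on_interval_imp_vector_derivative[OF C2] by blast
    have "(\<lambda>t. norm (g1 t)) integrable_on {a..b}"
      by (intro integrable_continuous_interval continuous_intros cont)
    \<comment> \<open>At the two ends one-sided derivatives may disagree with the neighbouring
      pieces, but two points do not affect integrability.\<close>
    moreover have "?f t = norm (g1 t)" if "t \<in> {a..b} - {a,b}" for t
      using vector_derivative_at[OF g1[of t]] that by auto
    ultimately show ?thesis
      by (intro integrable_spike_finite[of "{a,b}" "{a..b}" ?f "\<lambda>t. norm (g1 t)"]) auto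
  qed
  have "?f integrable_on {0..b}" if "b \<in> S" for b
    using that
  proof (induction "card {x\<in>S. x < b}" arbitrary: b rule: less_induct)
    case less
    show ?case
    proof (cases "b = 0")
      case True
      then show ?thesis using integrable_on_refl[of ?f 0] by simp
    next
      case False
      define a where "a = Max {x\<in>S. x < b}"
      have a: "a \<in> {x\<in>S. x < b}"
        unfolding a_def using S less.prems False by (intro Max_in) force+
      have max: "x \<le> a" if "x \<in> S" "x < b" for x
        unfolding a_def using S that by (intro Max_ge) auto
      have "card {x\<in>S. x < a} < card {x\<in>S. x < b}"
        using S a by (intro psubset_card_mono) auto
      then have "?f integrable_on {0..a}"
        using less.hyps a by blast
      moreover have "{a<..<b} \<inter> S = {}"
        using max by fastforce
      then have "?f integrable_on {a..b}"
        using C2 a less.prems by (intro piece) auto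
      ultimately show ?thesis
        using S a by (intro Henstock_Kurzweil_Integration.integrable_combine[of 0 a b]) auto
    qed
  qed
  with S show ?thesis by simp
qed

lemma norm_diff_le_integral_speed:
  assumes g: "piecewise_C2 g" and ab: "0 \<le> a" "a \<le> b" "b \<le> 1"
  shows "norm (g b - g a) \<le> integral {a..b} (\<lambda>t. norm (vector_derivative g (at t)))"
proof -
  obtain S where S: "finite S"
    "\<And>t. t \<in> {0..1} - S \<Longrightarrow> (g has_vector_derivative vector_derivative g (at t)) (at t)"
    using piecewise_C2_has_vector_derivative[OF g] by blast
  have "continuous_on {a..b} g"
    using g ab by (auto simp: piecewise_C2_def elim: continuous_on_subset)
  then have I: "((\<lambda>t. vector_derivative g (at t)) has_integral (g b - g a)) {a..b}"
    by (intro fundamental_theorem_of_calculus_interior_strong[OF S(1)])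
      (use S ab in auto)
  have "norm (integral {a..b} (\<lambda>t. vector_derivative g (at t)))
        \<le> integral {a..b} (\<lambda>t. norm (vector_derivative g (at t)))"
  proof (rule integral_norm_bound_integral)
    show "(\<lambda>t. norm (vector_derivative g (at t))) integrable_on {a..b}"
      by (rule integrable_on_subinterval[OF piecewise_C2_speed_integrable[OF g]]) (use ab in auto)
  qed (use I in auto)
  with I show ?thesis
    by (simp add: integral_unique)
qed

section \<open>Replacing a stretch of a curve by its chord\<close>

definition splice_chord :: "(real \<Rightarrow> 'a::real_vector) \<Rightarrow> real \<Rightarrow> real \<Rightarrow> real \<Rightarrow> 'a" where
  "splice_chord g s t u =
     (if s \<le> u \<and> u \<le> t then g s + ((u - s) / (t - s)) *\<^sub>R (g t - g s) else g u)"

lemma piecewise_C2_splice_chord: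
  assumes g: "piecewise_C2 g" and st: "0 \<le> s" "s < t" "t \<le> 1"
  shows "piecewise_C2 (splice_chord g s t)"
proof -
  let ?h = "splice_chord g s t"
  let ?l = "\<lambda>u. g s + ((u - s) / (t - s)) *\<^sub>R (g t - g s)"
  obtain S where S: "finite S"
    and C2: "\<And>a b. 0 \<le> a \<Longrightarrow> a < b \<Longrightarrow> b \<le> 1 \<Longrightarrow> {a<..<b} \<inter> S = {} \<Longrightarrow> C2_on_interval g a b"
    and cont: "continuous_on {0..1} g"
    using g unfolding piecewise_C2_iff by blast
  have le: "?h u = g u" if "u \<le> s" for u
    using that st by (cases "u = s") (auto simp: splice_chord_def)
  have ge: "?h u = g u" if "t \<le> u" for u
    using that st by (cases "u = t") (auto simp: splice_chord_def)
  have mid: "?h u = ?l u" if "u \<in> {s..t}" for u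
    using that by (auto simp: splice_chord_def)
  have "continuous_on ({0..s} \<union> {s..t} \<union> {t..1}) ?h"
  proof (intro continuous_on_closed_Un closed_Un closed_atLeastAtMost)
    show "continuous_on {0..s} ?h"
      by (rule continuous_on_eq[OF continuous_on_subset[OF cont]]) (use st le in auto)
    show "continuous_on {t..1} ?h"
      by (rule continuous_on_eq[OF continuous_on_subset[OF cont]]) (use st ge in auto)
    show "continuous_on {s..t} ?h"
    proof -
      have "continuous_on {s..t} ?l"
        using st by (intro continuous_intros) auto
      then show ?thesis
        by (rule continuous_on_eq) (use mid in auto)
    qed
  qed
  moreover have "{0..s} \<union> {s..t} \<union> {t..1} = {0..1}"
    using st by auto
  moreover have "C2_on_interval ?h a b"
    if ab: "0 \<le> a" "a < b" "b \<le> 1" "{a<..<b} \<inter> (S \<union> {s,t}) = {}" for a b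
  proof -
    consider "b \<le> s" | "t \<le> a" | "s \<le> a" "b \<le> t"
      using ab st by force
    then show ?thesis
    proof cases
      case 1
      have "C2_on_interval g a b"
        using ab by (intro C2) auto
      then show ?thesis
        by (rule C2_on_interval_cong) (use 1 le in auto)
    next
      case 2
      have "C2_on_interval g a b"
        using ab by (intro C2) auto
      then show ?thesis
        by (rule C2_on_interval_cong) (use 2 ge in auto)
    next
      case 3
      have "C2_on_interval ?l a b"
        unfolding C2_on_interval_def
        by (rule exI[of _ "\<lambda>_. (1 / (t - s)) *\<^sub>R (g t - g s)"], rule exI[of _ "\<lambda>_. 0"])
          (use st in \<open>auto intro!: derivative_eq_intros\<close>)
      then show ?thesis
        by (rule C2_on_interval_cong) (use 3 mid in auto)
    qed
  qed
  ultimately show ?thesis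
    unfolding piecewise_C2_iff using S
    by (intro conjI exI[of _ "S \<union> {s,t}"]) auto
qed

text \<open>Apart from the times \<open>s\<close> and \<open>t\<close>, the new curve either agrees
  with \<open>g\<close> near the given time or moves with the constant velocity of the chord. So its
  speed is known up to finitely many points, which the integrals ignore.\<close>

lemma curve_length_splice_chord:
  assumes g: "piecewise_C2 g" and st: "0 \<le> s" "s < t" "t \<le> 1"
  shows "curve_length (splice_chord g s t) + integral {s..t} (\<lambda>u. norm (vector_derivative g (at u)))
         = curve_length g + norm (g t - g s)"
proof -
  let ?h = "splice_chord g s t"
  let ?v = "\<lambda>f u. norm (vector_derivative f (at u))"
  have split: "integral {0..1} (?v f) = integral {0..s} (?v f) + integral {s..t} (?v f) + integral {t..1} (?v f)"
    if "piecewise_C2 f" for f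
  proof -
    have int: "?v f integrable_on {0..1}"
      using piecewise_C2_speed_integrable[OF that] .
    have "integral {0..s} (?v f) + integral {s..1} (?v f) = integral {0..1} (?v f)"
      using int st by (intro Henstock_Kurzweil_Integration.integral_combine) auto
    moreover have "integral {s..t} (?v f) + integral {t..1} (?v f) = integral {s..1} (?v f)"
      using integrable_on_subinterval[OF int, of s 1] st
      by (intro Henstock_Kurzweil_Integration.integral_combine) auto
    ultimately show ?thesis by simp
  qed
  have eq: "vector_derivative ?h (at u) = vector_derivative f (at u)"
    if "open V" "u \<in> V" "\<And>w. w \<in> V \<Longrightarrow> ?h w = f w" for u V f
    using that by (intro vector_derivative_cong_eq) (auto simp: eventually_nhds)
  have "integral {0..s} (?v ?h) = integral {0..s} (?v g)"
  proof (rule integral_spike[of "{s}"])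
    fix u assume "u \<in> {0..s} - {s}"
    then show "?v g u = ?v ?h u"
      by (subst eq[of "{..<s}"]) (auto simp: splice_chord_def)
  qed auto
  moreover have "integral {t..1} (?v ?h) = integral {t..1} (?v g)"
  proof (rule integral_spike[of "{t}"])
    fix u assume "u \<in> {t..1} - {t}"
    then show "?v g u = ?v ?h u"
      by (subst eq[of "{t<..}"]) (auto simp: splice_chord_def)
  qed auto
  moreover have "integral {s..t} (?v ?h) = integral {s..t} (\<lambda>_. norm (g t - g s) / (t - s))"
  proof (rule integral_spike[of "{s,t}"])
    fix u assume u: "u \<in> {s..t} - {s,t}"
    have "((\<lambda>u. g s + ((u - s) / (t - s)) *\<^sub>R (g t - g s)) has_vector_derivative
            (1 / (t - s)) *\<^sub>R (g t - g s)) (at u)"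
      using st by (auto intro!: derivative_eq_intros)
    then have "vector_derivative ?h (at u) = (1 / (t - s)) *\<^sub>R (g t - g s)"
      using u by (subst eq[of "{s<..<t}" u "\<lambda>u. g s + ((u - s) / (t - s)) *\<^sub>R (g t - g s)"])
        (auto simp: splice_chord_def dest: vector_derivative_at)
    then show "norm (g t - g s) / (t - s) = ?v ?h u"
      using st by simp
  qed auto
  moreover have "\<dots> = norm (g t - g s)"
    using st by simp
  ultimately show ?thesis
    unfolding curve_length_def split[OF g] split[OF piecewise_C2_splice_chord[OF assms]]
    by simp
qed

text \<open>The spliced curve is a competitor, so from \<open>s\<close> to \<open>t\<close> the
  curve is no longer than the chord. The triangle inequality through \<open>g u\<close> is then an
  equality, which places \<open>g u\<close> between the ends. Only this location is claimed, nothing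
  about speed or order.\<close>

lemma shortest_curve_follows_chord:
  assumes g: "shortest_curve X A B g" and st: "0 \<le> s" "s \<le> t" "t \<le> 1"
    and X: "closed_segment (g s) (g t) \<subseteq> X" and u: "u \<in> {s..t}"
  shows "g u \<in> closed_segment (g s) (g t)"
proof (cases "s = t")
  case True
  with u show ?thesis by auto
next
  case False
  with st have "s < t" by simp
  let ?v = "\<lambda>u. norm (vector_derivative g (at u))"
  have pc: "piecewise_C2 g" and gX: "g ` {0..1} \<subseteq> X" and ends: "g 0 = A" "g 1 = B"
    using g by (auto simp: shortest_curve_def admissible_curve_def)
  have "admissible_curve X A B (splice_chord g s t)"
    unfolding admissible_curve_def
  proof (intro conjI)
    show "splice_chord g s t ` {0..1} \<subseteq> X"
    proof (rule image_subsetI)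
      fix w :: real assume w: "w \<in> {0..1}"
      have "g s + ((w - s) / (t - s)) *\<^sub>R (g t - g s) \<in> closed_segment (g s) (g t)" if "s \<le> w" "w \<le> t"
        unfolding closed_segment_def using that \<open>s < t\<close>
        by (intro CollectI exI[of _ "(w - s) / (t - s)"]) (auto simp: algebra_simps)
      with w X gX show "splice_chord g s t w \<in> X"
        unfolding splice_chord_def by auto
    qed
    show "splice_chord g s t 0 = A" "splice_chord g s t 1 = B"
      using ends st \<open>s < t\<close> by (auto simp: splice_chord_def)
  qed (rule piecewise_C2_splice_chord[OF pc st(1) \<open>s < t\<close> st(3)])
  with g have "curve_length g \<le> curve_length (splice_chord g s t)"
    unfolding shortest_curve_def by blast
  with curve_length_splice_chord[OF pc st(1) \<open>s < t\<close> st(3)]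
  have "integral {s..t} ?v \<le> norm (g t - g s)"
    by simp
  moreover have "integral {s..u} ?v + integral {u..t} ?v = integral {s..t} ?v"
    using piecewise_C2_speed_integrable[OF pc] st u
    by (intro Henstock_Kurzweil_Integration.integral_combine) (auto intro: integrable_on_subinterval)
  moreover have "norm (g u - g s) \<le> integral {s..u} ?v" "norm (g t - g u) \<le> integral {u..t} ?v"
    using u st by (auto intro!: norm_diff_le_integral_speed[OF pc])
  ultimately have "dist (g s) (g u) + dist (g u) (g t) \<le> dist (g s) (g t)"
    by (simp add: dist_norm norm_minus_commute)
  then have "dist (g s) (g t) = dist (g s) (g u) + dist (g u) (g t)"
    using dist_triangle[of "g s" "g t" "g u"] by simp
  then show ?thesis
    using between between_mem_segment by blast
qed

section \<open>Components and dyadic partitions\<close>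

text \<open>Among points of three components that meet \<open>V\<close>, two consecutive ones would
  be joined by an interval inside \<open>T\<close>. So \<open>V\<close> meets at most two
  components, and finitely many such \<open>V\<close> cover \<open>K\<close>. The condition is
  imposed on all of \<open>K\<close> because components may accumulate at points outside
  \<open>T\<close>.\<close>

lemma finite_components_locally_two:
  fixes T :: "real set"
  assumes K: "compact K" "T \<subseteq> K"
    and loc: "\<And>t. t \<in> K \<Longrightarrow> \<exists>V. open V \<and> t \<in> V \<and>
       (\<forall>t1\<in>T \<inter> V. \<forall>t2\<in>T \<inter> V. \<forall>t3\<in>T \<inter> V. t1 < t2 \<longrightarrow> t2 < t3 \<longrightarrow> {t1..t2} \<subseteq> T \<or> {t2..t3} \<subseteq> T)"
  shows "finite (components T)"
proof -
  define Q where "Q V \<longleftrightarrow> (\<forall>t1\<in>T \<inter> V. \<forall>t2\<in>T \<inter> V. \<forall>t3\<in>T \<inter> V.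
    t1 < t2 \<longrightarrow> t2 < t3 \<longrightarrow> {t1..t2} \<subseteq> T \<or> {t2..t3} \<subseteq> T)" for V
  have "\<forall>t\<in>K. \<exists>V. open V \<and> t \<in> V \<and> Q V"
    unfolding Q_def by (intro ballI loc)
  from bchoice[OF this] obtain V where "\<forall>t\<in>K. open (V t) \<and> t \<in> V t \<and> Q (V t)" ..
  then have V: "open (V t)" "t \<in> V t" "Q (V t)" if "t \<in> K" for t
    using that by auto
  have fin: "finite {c \<in> components T. c \<inter> V t \<noteq> {}}" if t: "t \<in> K" for t
  proof (rule ccontr)
    define D where "D = {c \<in> components T. c \<inter> V t \<noteq> {}}"
    assume "infinite {c \<in> components T. c \<inter> V t \<noteq> {}}"
    then have "infinite D" by (simp add: D_def)
    define f where "f c = (SOME x. x \<in> c \<inter> V t)" for c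
    have f: "f c \<in> c \<inter> V t" if "c \<in> D" for c
      unfolding f_def some_in_eq using that by (simp add: D_def)
    have comp: "c \<in> components T" if "c \<in> D" for c
      using that by (simp add: D_def)
    have inT: "f c \<in> T \<inter> V t" if "c \<in> D" for c
      using f[OF that] in_components_subset[OF comp[OF that]] by auto
    have rep: "connected_component_set T (f c) = c" if c: "c \<in> D" for c
    proof -
      obtain x where "c = connected_component_set T x"
        using comp[OF c] by (auto simp: components_def)
      with f[OF c] show ?thesis
        using connected_component_eq[of "f c" T x] by simp
    qed
    have same: "c = d" if "c \<in> D" "d \<in> D" "{f c..f d} \<subseteq> T" "f c \<le> f d" for c d
    proof -
      have "connected_component T (f c) (f d)"
        unfolding connected_component_def using that by (intro exI[of _ "{f c..f d}"]) auto
      then have "f d \<in> connected_component_set T (f c)" by simp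
      from connected_component_eq[OF this] show ?thesis
        using rep[OF that(1)] rep[OF that(2)] by simp
    qed
    have inj: "inj_on f D"
    proof (rule inj_onI)
      fix c d assume "c \<in> D" "d \<in> D" "f c = f d"
      then show "c = d" using same[of c d] inT[of c] by auto
    qed
    have "infinite (f ` D)"
      using \<open>infinite D\<close> inj finite_imageD by blast
    then obtain R where R: "R \<subseteq> f ` D" "finite R" "card R = 3"
      using infinite_arbitrarily_large by blast
    have no: False if abc: "a < b" "b < c" "a \<in> R" "b \<in> R" "c \<in> R" for a b c
    proof -
      have "a \<in> f ` D" "b \<in> f ` D" "c \<in> f ` D" using abc R(1) by auto
      then obtain ca cb cc where *: "ca \<in> D" "cb \<in> D" "cc \<in> D" "a = f ca" "b = f cb" "c = f cc"
        by (elim imageE)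
      then have "{a..b} \<subseteq> T \<or> {b..c} \<subseteq> T"
        using V(3)[OF t] inT[of ca] inT[of cb] inT[of cc] abc unfolding Q_def by fast
      then have "ca = cb \<or> cb = cc" using same[of ca cb] same[of cb cc] * abc by auto
      with * abc show False by auto
    qed
    obtain x y z where xyz: "R = {x,y,z}" "x \<noteq> y" "x \<noteq> z" "y \<noteq> z"
      using R(3) card_3_iff by metis
    then consider "x < y" "y < z" | "x < z" "z < y" | "y < x" "x < z" | "y < z" "z < x" | "z < x" "x < y" | "z < y" "y < x"
      by linarith
    then show False
      by cases (rule no, assumption, assumption, simp_all add: xyz(1))+
  qed
  have "\<exists>K'\<subseteq>K. finite K' \<and> K \<subseteq> (\<Union>t\<in>K'. V t)"
    using compactE_image[OF K(1), of K V] V(1,2) by (metis UN_I subsetI)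
  then obtain K' where K': "K' \<subseteq> K" "finite K'" "K \<subseteq> (\<Union>t\<in>K'. V t)"
    by blast
  have "components T \<subseteq> (\<Union>t\<in>K'. {c \<in> components T. c \<inter> V t \<noteq> {}})"
  proof
    fix c assume c: "c \<in> components T"
    then obtain x where "x \<in> c" "x \<in> K"
      using in_components_nonempty[OF c] in_components_subset[OF c] K(2) by auto
    with K' obtain t where "t \<in> K'" "x \<in> V t" by blast
    with c \<open>x \<in> c\<close> show "c \<in> (\<Union>t\<in>K'. {c \<in> components T. c \<inter> V t \<noteq> {}})" by blast
  qed
  with fin K' show ?thesis
    by (meson finite_UN_I finite_subset subsetD)
qed

text \<open>Every point is put into the class of the first generation that is good; the refinement
  property makes these classes pairwise equal or disjoint.\<close>
lemma nested_partition_selection: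
  fixes E :: "nat \<Rightarrow> 'a \<Rightarrow> 'a set"
  assumes refl: "\<And>n x. x \<in> E n x"
    and eq: "\<And>n x y. y \<in> E n x \<Longrightarrow> E n y = E n x"
    and nested: "\<And>n x. E (Suc n) x \<subseteq> E n x"
    and countable: "\<And>n. countable (range (E n))"
    and good: "\<And>x. x \<in> W \<Longrightarrow> \<exists>n. P (E n x)"
    and sub: "\<And>n x. P (E n x) \<Longrightarrow> E n x \<subseteq> W"
  obtains D where "countable D" "\<Union>D = W" "pairwise disjnt D"
    "\<And>e. e \<in> D \<Longrightarrow> P e \<and> (\<exists>n. \<exists>x\<in>W. e = E n x)"
proof -
  define N where "N x = (LEAST n. P (E n x))" for x
  have PN: "P (E (N x) x)" if "x \<in> W" for x
    unfolding N_def using good[OF that] by (rule LeastI_ex)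
  have mono: "E n x \<subseteq> E m x" if "m \<le> n" for m n x
    using that nested by (simp add: lift_Suc_antimono_le[of "\<lambda>n. E n x"])
  have same: "N y = N x" if y: "y \<in> E (N x) x" and "x \<in> W" for x y
  proof -
    have *: "E m y = E m x" if "m \<le> N x" for m
      using mono[OF that] y by (intro eq) blast
    show ?thesis
      unfolding N_def[of y]
    proof (rule Least_equality)
      show "P (E (N x) y)" using * PN[OF \<open>x \<in> W\<close>] by simp
      fix m assume "P (E m y)"
      show "N x \<le> m"
      proof (rule ccontr)
        assume "\<not> N x \<le> m"
        with * \<open>P (E m y)\<close> have "P (E m x)" "m < N x" by auto
        then show False unfolding N_def using not_less_Least by blast
      qed
    qed
  qed
  let ?D = "(\<lambda>x. E (N x) x) ` W"
  show ?thesis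
  proof (rule that[of ?D])
    have "?D \<subseteq> (\<Union>n. range (E n))" by auto
    then show "countable ?D"
      by (rule countable_subset) (simp add: countable)
    show "\<Union>?D = W"
      using refl PN sub by fast
    show "pairwise disjnt ?D"
    proof (rule pairwiseI)
      fix a b assume "a \<in> ?D" "b \<in> ?D" "a \<noteq> b"
      then obtain x y where xy: "x \<in> W" "y \<in> W" "a = E (N x) x" "b = E (N y) y" by blast
      show "disjnt a b"
      proof (rule ccontr)
        assume "\<not> disjnt a b"
        then obtain z where z: "z \<in> a" "z \<in> b" by (auto simp: disjnt_def)
        then have "N x = N y" using same xy by metis
        then have "a = b" using eq z xy by metis
        with \<open>a \<noteq> b\<close> show False by simp
      qed
    qed
    show "P e \<and> (\<exists>n. \<exists>x\<in>W. e = E n x)" if "e \<in> ?D" for e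
      using that PN by blast
  qed
qed

text \<open>Floor alone would give half-open intervals, which are not homeomorphic to the line.
  Adding the ceiling separates the grid points, so a class is a single grid point or an open
  interval between two neighbouring ones.\<close>

definition dyadic_cell :: "nat \<Rightarrow> real \<Rightarrow> real set" where
  "dyadic_cell n x = {w. \<lfloor>2^n * w\<rfloor> = \<lfloor>2^n * x\<rfloor> \<and> \<lceil>2^n * w\<rceil> = \<lceil>2^n * x\<rceil>}"

lemma dyadic_cell_refl: "x \<in> dyadic_cell n x"
  by (simp add: dyadic_cell_def)

lemma dyadic_cell_eq: "y \<in> dyadic_cell n x \<Longrightarrow> dyadic_cell n y = dyadic_cell n x"
  by (auto simp: dyadic_cell_def)

text \<open>The floor of \<open>y\<close> is determined by that of \<open>2 * y\<close>, and
  likewise the ceiling after a change of sign; so a finer class determines the coarser one.\<close>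

lemma dyadic_cell_nested: "dyadic_cell (Suc n) x \<subseteq> dyadic_cell n x"
proof -
  have fl: "\<lfloor>y\<rfloor> = \<lfloor>2 * y\<rfloor> div 2" for y :: real
    using floor_divide_real_eq_div[of 2 "2 * y"] by simp
  have ce: "\<lceil>y\<rceil> = - ((- \<lceil>2 * y\<rceil>) div 2)" for y :: real
    using fl[of "- y"] by (simp add: ceiling_def)
  show ?thesis
  proof
    fix w assume "w \<in> dyadic_cell (Suc n) x"
    then have "\<lfloor>2 * (2^n * w)\<rfloor> = \<lfloor>2 * (2^n * x)\<rfloor>" "\<lceil>2 * (2^n * w)\<rceil> = \<lceil>2 * (2^n * x)\<rceil>"
      by (auto simp: dyadic_cell_def mult.assoc)
    then show "w \<in> dyadic_cell n x"
      unfolding dyadic_cell_def using fl[of "2^n * w"] fl[of "2^n * x"] ce[of "2^n * w"] ce[of "2^n * x"]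
      by simp
  qed
qed

lemma countable_range_dyadic_cell: "countable (range (dyadic_cell n))"
proof -
  have "range (dyadic_cell n) \<subseteq> range (\<lambda>(k, l). {w. \<lfloor>2^n * w\<rfloor> = k \<and> \<lceil>2^n * w\<rceil> = l})"
    unfolding dyadic_cell_def by auto
  then show ?thesis
    by (rule countable_subset) simp
qed

lemma dyadic_cell_cases:
  obtains "dyadic_cell n x = {x}"
  | a b where "a < x" "x < b" "b - a = 1 / 2^n" "dyadic_cell n x = {a<..<b}"
proof (cases "2^n * x \<in> \<int>")
  case True
  then obtain k where k: "2^n * x = of_int k" by (auto elim: Ints_cases)
  have "w = x" if "w \<in> dyadic_cell n x" for w
  proof -
    have "\<lfloor>2^n * w\<rfloor> = k" "\<lceil>2^n * w\<rceil> = k"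
      using that k by (auto simp: dyadic_cell_def)
    then have "2^n * w = of_int k"
      by linarith
    then have "2^n * w = 2^n * x" using k by simp
    then show ?thesis by simp
  qed
  then have "dyadic_cell n x = {x}"
    using dyadic_cell_refl by blast
  then show ?thesis using that by blast
next
  case False
  define k where "k = \<lfloor>2^n * x\<rfloor>"
  have k: "of_int k < 2^n * x" "2^n * x < of_int k + 1"
    using False unfolding k_def by (metis Ints_of_int floor_correct le_less) linarith
  have iff: "w \<in> dyadic_cell n x \<longleftrightarrow> of_int k < 2^n * w \<and> 2^n * w < of_int k + 1" for w
  proof -
    have "\<lceil>2^n * x\<rceil> = k + 1" using k by linarith
    then show ?thesis
      unfolding dyadic_cell_def mem_Collect_eq k_def[symmetric] by linarith
  qed
  define a b where "a = of_int k / (2::real)^n" and "b = (of_int k + 1) / (2::real)^n"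
  have ab: "a < w \<longleftrightarrow> of_int k < 2^n * w" "w < b \<longleftrightarrow> 2^n * w < of_int k + 1" for w
    unfolding a_def b_def by (simp_all add: pos_divide_less_eq pos_less_divide_eq mult.commute)
  have "dyadic_cell n x = {a<..<b}"
    by (rule set_eqI) (simp add: iff ab)
  moreover have "a < x" "x < b"
    using k by (simp_all add: ab)
  moreover have "b - a = 1 / 2^n"
    unfolding a_def b_def by (simp add: add_divide_distrib)
  ultimately show ?thesis by (intro that(2))
qed

lemma dyadic_cell_dist: "w \<in> dyadic_cell n x \<Longrightarrow> \<bar>w - x\<bar> < 1 / 2^n"
  by (cases rule: dyadic_cell_cases[of n x]) auto

lemma inverse_power_two_less: "e > 0 \<Longrightarrow> \<exists>n. 1 / 2^n < (e::real)"
  using real_arch_pow_inv[of e "1/2"] by (auto simp: power_one_over)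

text \<open>The closed interval \<open>{a..b}\<close>, not only the cell, lies in \<open>W\<close>.
  This is what keeps an arc away from the exceptional points, and the reason why infinitely many
  cells may be necessary: they shrink towards the boundary of \<open>W\<close>.\<close>

lemma open_real_interval_partition:
  fixes W :: "real set"
  assumes "open W"
  obtains D where "countable D" "\<Union>D = W" "pairwise disjnt D"
    "\<And>e. e \<in> D \<Longrightarrow> (\<exists>x. e = {x}) \<or> (\<exists>a b. a < b \<and> {a..b} \<subseteq> W \<and> e = {a<..<b})"
proof -
  define P where "P e \<longleftrightarrow> (\<exists>x\<in>W. e = {x}) \<or> (\<exists>a b. a < b \<and> {a..b} \<subseteq> W \<and> e = {a<..<b})" for e
  have good: "\<exists>n. P (dyadic_cell n x)" if x: "x \<in> W" for x
  proof -
    obtain r where r: "r > 0" "ball x r \<subseteq> W"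
      using assms x open_contains_ball by blast
    obtain n where n: "1 / 2^n < r"
      using inverse_power_two_less r by blast
    have "P (dyadic_cell n x)"
    proof (cases rule: dyadic_cell_cases[of n x])
      case 1
      with x show ?thesis by (auto simp: P_def)
    next
      case (2 a b)
      have "{a..b} \<subseteq> ball x r"
        using 2(1-3) n by (auto simp: dist_real_def)
      with 2 r show ?thesis
        unfolding P_def by (intro disjI2 exI[of _ a] exI[of _ b]) auto
    qed
    then show ?thesis ..
  qed
  have sub: "dyadic_cell n x \<subseteq> W" if "P (dyadic_cell n x)" for n x
    using that unfolding P_def by (elim disjE exE bexE conjE) (force intro: less_imp_le)+
  obtain D where D: "countable D" "\<Union>D = W" "pairwise disjnt D"
    "\<And>e. e \<in> D \<Longrightarrow> P e \<and> (\<exists>n. \<exists>x\<in>W. e = dyadic_cell n x)"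
    using nested_partition_selection[of dyadic_cell W P, OF dyadic_cell_refl dyadic_cell_eq
        dyadic_cell_nested countable_range_dyadic_cell good sub] by blast
  show ?thesis
    by (rule that[OF D(1-3)]) (use D(4) in \<open>unfold P_def, blast\<close>)
qed

section \<open>Dyadic boxes in the plane\<close>

lemma is_cell_dyadic_box: "is_cell (dyadic_cell n x \<times> dyadic_cell n y)"
proof -
  have I: "{a<..<b} homeomorphic (UNIV :: real set)" if "a < b" for a b :: real
    using that by (intro homeomorphic_open_interval_UNIV) auto
  show ?thesis
  proof (cases rule: dyadic_cell_cases[of n x])
    case 1
    note x = 1
    show ?thesis
    proof (cases rule: dyadic_cell_cases[of n y])
      case 1
      with x show ?thesis by (auto simp: is_cell_def)
    next
      case (2 a b)
      have "{x} \<times> {a<..<b} homeomorphic {a<..<b}"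
        by (rule homeomorphicI[where f = snd and g = "\<lambda>t. (x, t)"]) (auto intro!: continuous_intros simp: image_iff)
      moreover have "a < b" using 2 by simp
      ultimately show ?thesis
        using x 2 I homeomorphic_trans unfolding is_cell_def by metis
    qed
  next
    case (2 a b)
    note x = 2
    show ?thesis
    proof (cases rule: dyadic_cell_cases[of n y])
      case 1
      have "{a<..<b} \<times> {y} homeomorphic {a<..<b}"
        by (rule homeomorphicI[where f = fst and g = "\<lambda>t. (t, y)"]) (auto intro!: continuous_intros simp: image_iff)
      moreover have "a < b" using x by simp
      ultimately show ?thesis
        using x 1 I homeomorphic_trans unfolding is_cell_def by metis
    next
      case (2 c d)
      have "{a<..<b} \<times> {c<..<d} = box (a, c) (b, d)"
        by (auto simp: box_def Basis_prod_def)
      moreover have "box (a, c) (b, d) homeomorphic (UNIV :: (real \<times> real) set)"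
        using x 2 calculation by (intro homeomorphic_box_UNIV) (auto simp flip: calculation)
      ultimately show ?thesis
        using x 2 unfolding is_cell_def by simp
    qed
  qed
qed

lemma convex_dyadic_cell: "convex (dyadic_cell n x)"
  by (cases rule: dyadic_cell_cases[of n x]) (simp_all add: convex_real_interval)

lemma open_plane_convex_partition:
  fixes W :: "(real \<times> real) set"
  assumes "open W"
  obtains D where "countable D" "\<Union>D = W" "pairwise disjnt D"
    "\<And>e. e \<in> D \<Longrightarrow> convex e \<and> is_cell e"
proof -
  define E where "E n z = dyadic_cell n (fst z) \<times> dyadic_cell n (snd z)" for n and z :: "real \<times> real"
  have good: "\<exists>n. E n z \<subseteq> W" if z: "z \<in> W" for z
  proof -
    obtain r where r: "r > 0" "ball z r \<subseteq> W"
      using assms z open_contains_ball by blast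
    \<comment> \<open>Half the radius for each coordinate, since the distance is bounded by the sum
      of the coordinate differences.\<close>
    obtain n where n: "1 / 2^n < r / 2"
      using inverse_power_two_less[of "r / 2"] r by auto
    have "E n z \<subseteq> ball z r"
    proof
      fix w assume "w \<in> E n z"
      then have "\<bar>fst w - fst z\<bar> < r / 2" "\<bar>snd w - snd z\<bar> < r / 2"
        using dyadic_cell_dist n unfolding E_def by (force simp: mem_Times_iff)+
      moreover have "dist z w \<le> \<bar>fst w - fst z\<bar> + \<bar>snd w - snd z\<bar>"
        using sqrt_sum_squares_le_sum_abs[of "fst z - fst w" "snd z - snd w"]
        by (simp add: dist_prod_def dist_real_def)
      ultimately show "w \<in> ball z r" by simp
    qed
    with r show ?thesis by blast
  qed
  have cnt: "countable (range (E n))" for n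
  proof -
    have "range (E n) \<subseteq> (\<lambda>(a, b). a \<times> b) ` (range (dyadic_cell n) \<times> range (dyadic_cell n))"
      unfolding E_def by auto
    then show ?thesis
      by (rule countable_subset) (simp add: countable_range_dyadic_cell)
  qed
  have refl: "z \<in> E n z" for n z
    unfolding E_def using dyadic_cell_refl by (simp add: mem_Times_iff)
  have eq: "E n y = E n z" if "y \<in> E n z" for n y z
    using that unfolding E_def by (metis dyadic_cell_eq mem_Times_iff)
  have nested: "E (Suc n) z \<subseteq> E n z" for n z
    unfolding E_def using dyadic_cell_nested by (intro Sigma_mono)
  obtain D where D: "countable D" "\<Union>D = W" "pairwise disjnt D"
    "\<And>e. e \<in> D \<Longrightarrow> e \<subseteq> W \<and> (\<exists>n. \<exists>x\<in>W. e = E n x)"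
    using nested_partition_selection[of E W "\<lambda>e. e \<subseteq> W", OF refl eq nested cnt good] by blast
  show ?thesis
  proof (rule that[OF D(1-3)])
    show "convex e \<and> is_cell e" if "e \<in> D" for e
      using D(4)[OF that] unfolding E_def
      by (auto intro: convex_Times convex_dyadic_cell is_cell_dyadic_box)
  qed
qed

section \<open>Cells met finitely often\<close>

lemma shortest_curve_in: "shortest_curve X A B g \<Longrightarrow> u \<in> {0..1} \<Longrightarrow> g u \<in> X"
  by (auto simp: shortest_curve_def admissible_curve_def)

lemma shortest_curve_continuous: "shortest_curve X A B g \<Longrightarrow> continuous_on {0..1} g"
  by (auto simp: shortest_curve_def admissible_curve_def piecewise_C2_def)

text \<open>The case of a degenerate chord: a shortest curve that is at the same point at two times
  has rested there in between.\<close>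

lemma shortest_curve_constant:
  assumes "shortest_curve X A B g" "0 \<le> s" "t \<le> 1" "g s = g t" "u \<in> {s..t}"
  shows "g u = g s"
proof -
  have "g u \<in> closed_segment (g s) (g t)"
    using assms shortest_curve_in[OF assms(1), of s]
    by (intro shortest_curve_follows_chord[OF assms(1)]) auto
  with assms show ?thesis by simp
qed

lemma convex_interacts_finitely:
  assumes g: "shortest_curve X A B g" and e: "convex e" "e \<subseteq> X"
  shows "interacts_finitely g e"
proof -
  let ?T = "{t \<in> {0..1}. g t \<in> e}"
  have "u \<in> ?T" if "s \<in> ?T" "t \<in> ?T" "s \<le> u" "u \<le> t" for s t u
  proof -
    have seg: "closed_segment (g s) (g t) \<subseteq> e"
      using that e by (intro closed_segment_subset) auto
    have "g u \<in> closed_segment (g s) (g t)"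
      using that seg e by (intro shortest_curve_follows_chord[OF g]) auto
    with seg that show ?thesis by auto
  qed
  then have "is_interval ?T"
    unfolding is_interval_1 by blast
  then have "connected ?T"
    using is_interval_connected by blast
  then show ?thesis
    unfolding interacts_finitely_def
    by (metis (no_types, lifting) components_eq_sing_iff components_empty finite.emptyI finite.insertI)
qed

text \<open>There are two sets because \<open>X\<close> is assembled from pieces \<open>Y\<close>,
  each with its own decomposition, while the curves remain shortest in the whole of
  \<open>X\<close>.\<close>

definition tame :: "(real \<times> real) set \<Rightarrow> (real \<times> real) set \<Rightarrow> bool" where
  "tame X Y \<longleftrightarrow> (\<exists>C. cell_decomposition Y C \<and>
     (\<forall>A B g. shortest_curve X A B g \<longrightarrow> (\<forall>e\<in>C. interacts_finitely g e)))"

lemma tame_Union: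
  assumes "countable \<Y>" "pairwise disjnt \<Y>" "\<And>Y. Y \<in> \<Y> \<Longrightarrow> tame X Y"
  shows "tame X (\<Union>\<Y>)"
proof -
  have "\<forall>Y\<in>\<Y>. \<exists>C. cell_decomposition Y C \<and>
     (\<forall>A B g. shortest_curve X A B g \<longrightarrow> (\<forall>e\<in>C. interacts_finitely g e))"
    using assms(3) unfolding tame_def by blast
  from bchoice[OF this] obtain C where "\<forall>Y\<in>\<Y>. cell_decomposition Y (C Y) \<and>
     (\<forall>A B g. shortest_curve X A B g \<longrightarrow> (\<forall>e\<in>C Y. interacts_finitely g e))" ..
  then have C: "cell_decomposition Y (C Y)"
    and fin: "\<And>A B g e. shortest_curve X A B g \<Longrightarrow> e \<in> C Y \<Longrightarrow> interacts_finitely g e"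
    if "Y \<in> \<Y>" for Y
    using that by blast+
  have U: "\<Union>(C Y) = Y" if "Y \<in> \<Y>" for Y
    using C[OF that] by (simp add: cell_decomposition_def)
  have "cell_decomposition (\<Union>\<Y>) (\<Union>Y\<in>\<Y>. C Y)"
    unfolding cell_decomposition_def
  proof (intro conjI ballI impI)
    show "countable (\<Union>Y\<in>\<Y>. C Y)"
      using assms(1) C by (auto simp: cell_decomposition_def)
    show "\<Union>(\<Union>Y\<in>\<Y>. C Y) = \<Union>\<Y>"
      using U by blast
    show "is_cell e" if "e \<in> (\<Union>Y\<in>\<Y>. C Y)" for e
      using that C by (auto simp: cell_decomposition_def)
    fix e1 e2 assume e: "e1 \<in> (\<Union>Y\<in>\<Y>. C Y)" "e2 \<in> (\<Union>Y\<in>\<Y>. C Y)" "e1 \<noteq> e2"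
    then obtain Y1 Y2 where Y: "Y1 \<in> \<Y>" "Y2 \<in> \<Y>" "e1 \<in> C Y1" "e2 \<in> C Y2" by blast
    show "e1 \<inter> e2 = {}"
    proof (cases "Y1 = Y2")
      case True
      with C[OF Y(1)] Y e show ?thesis by (simp add: cell_decomposition_def)
    next
      case False
      have "e1 \<subseteq> Y1" "e2 \<subseteq> Y2" using U Y by blast+
      moreover have "Y1 \<inter> Y2 = {}"
        using assms(2) Y False by (simp add: pairwise_def disjnt_def)
      ultimately show ?thesis by blast
    qed
  qed
  then show ?thesis
    unfolding tame_def using fin by (intro exI[of _ "\<Union>Y\<in>\<Y>. C Y"]) blast
qed

lemma tame_Un: "tame X Y \<Longrightarrow> tame X Z \<Longrightarrow> disjnt Y Z \<Longrightarrow> tame X (Y \<union> Z)"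
  using tame_Union[of "{Y, Z}" X] by (auto simp: pairwise_insert disjnt_sym)

lemma tame_countable:
  assumes "countable F" "F \<subseteq> X"
  shows "tame X F"
  unfolding tame_def
proof (intro exI[of _ "(\<lambda>z. {z}) ` F"] conjI allI impI ballI)
  show "cell_decomposition F ((\<lambda>z. {z}) ` F)"
    using assms by (auto simp: cell_decomposition_def is_cell_def)
  show "interacts_finitely g e" if "shortest_curve X A B g" "e \<in> (\<lambda>z. {z}) ` F" for A B g e
    using that assms by (intro convex_interacts_finitely[OF that(1)]) auto
qed

lemma tame_open:
  assumes "open W" "W \<subseteq> X"
  shows "tame X W"
proof -
  obtain D where D: "countable D" "\<Union>D = W" "pairwise disjnt D" "\<And>e. e \<in> D \<Longrightarrow> convex e \<and> is_cell e"
    using open_plane_convex_partition[OF assms(1)] by blast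
  show ?thesis
    unfolding tame_def
  proof (intro exI[of _ D] conjI allI impI ballI)
    show "cell_decomposition W D"
      using D by (auto simp: cell_decomposition_def pairwise_def disjnt_def)
    show "interacts_finitely g e" if "shortest_curve X A B g" "e \<in> D" for A B g e
      using that assms D by (intro convex_interacts_finitely[OF that(1)]) auto
  qed
qed

text \<open>Here \<open>\<psi>\<close> is a defining function of an edge, and \<open>qc\<close>
  makes \<open>{\<psi> > 0}\<close> its convex side. By \<open>intr\<close>, \<open>X\<close> is a
  neighbourhood of each of its points off the edge; by \<open>side\<close>, it contains all or
  nothing of \<open>{\<psi> > 0}\<close> within \<open>U\<close>. Which sides occur is left open.
  The conclusion about three contact times is shaped for
  \<open>finite_components_locally_two\<close>.\<close>

lemma shortest_curve_no_double_touch: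
  fixes \<psi> :: "real \<times> real \<Rightarrow> real"
  assumes g: "shortest_curve X A B g"
    and U: "convex U" and cont: "continuous_on U \<psi>"
    and qc: "\<And>P Q w. P \<in> U \<Longrightarrow> Q \<in> U \<Longrightarrow> w \<in> open_segment P Q \<Longrightarrow> min (\<psi> P) (\<psi> Q) < \<psi> w"
    and intr: "\<And>w. w \<in> U \<inter> X \<Longrightarrow> \<psi> w \<noteq> 0 \<Longrightarrow> w \<in> interior X"
    and side: "\<And>w z. w \<in> U \<inter> X \<Longrightarrow> 0 < \<psi> w \<Longrightarrow> z \<in> U \<Longrightarrow> 0 < \<psi> z \<Longrightarrow> z \<in> X"
    and t: "0 \<le> t1" "t1 \<le> t2" "t2 \<le> t3" "t3 \<le> 1" and gU: "g ` {t1..t3} \<subseteq> U"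
    and zero: "\<psi> (g t1) = 0" "\<psi> (g t2) = 0" "\<psi> (g t3) = 0"
  shows "(\<forall>s\<in>{t1..t2}. \<psi> (g s) = 0) \<or> (\<forall>s\<in>{t2..t3}. \<psi> (g s) = 0)"
proof -
  have contg: "continuous_on {t1..t3} g"
    using shortest_curve_continuous[OF g] t by (auto elim: continuous_on_subset)
  have gX: "g s \<in> U \<inter> X" if "s \<in> {t1..t3}" for s
    using gU that shortest_curve_in[OF g, of s] t by auto
  have "continuous_on {t1..t3} (\<lambda>s. \<psi> (g s))"
    by (rule continuous_on_compose2[OF cont contg gU])
  moreover have "{t1..t3} \<noteq> {}" using t by auto
  ultimately obtain s0 where s0: "s0 \<in> {t1..t3}" and min: "\<And>s. s \<in> {t1..t3} \<Longrightarrow> \<psi> (g s0) \<le> \<psi> (g s)"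
    using continuous_attains_inf[OF compact_Icc] by blast
  have "\<psi> (g s0) \<ge> 0"
  proof (rule ccontr)
    assume neg: "\<not> \<psi> (g s0) \<ge> 0"
    define w0 where "w0 = g s0"
    have "w0 \<in> interior X"
      using intr[OF gX[OF s0]] neg by (simp add: w0_def)
    then obtain r where r: "r > 0" "ball w0 r \<subseteq> X"
      by (meson mem_interior)
    \<comment> \<open>The curve may rest at \<open>w0\<close> or come back to it. Times before the
      first and after the last visit give chord ends different from \<open>w0\<close>, so that
      \<open>w0\<close> lies in the open segment and strict quasiconcavity contradicts
      minimality.\<close>
    define M where "M = {s \<in> {t1..t3}. g s = w0}"
    have "closed M"
      unfolding M_def using contg by (intro continuous_closed_preimage_constant) auto
    then have M: "compact M"
      using compact_Int_closed[OF compact_Icc[of t1 t3], of M]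
      by (simp add: Int_absorb1 M_def subset_iff)
    have "M \<noteq> {}" using s0 by (auto simp: M_def w0_def)
    with M obtain a b where a: "a \<in> M" "\<And>s. s \<in> M \<Longrightarrow> a \<le> s" and b: "b \<in> M" "\<And>s. s \<in> M \<Longrightarrow> s \<le> b"
      using compact_attains_inf[OF M] compact_attains_sup[OF M] by blast
    have "a \<noteq> t1" "b \<noteq> t3"
      using a(1) b(1) neg zero by (auto simp: M_def w0_def)
    then have ab: "t1 < a" "a \<le> b" "b < t3"
      using a b by (auto simp: M_def)
    have near: "\<exists>d>0. \<forall>s\<in>{t1..t3}. dist s c < d \<longrightarrow> g s \<in> ball w0 r" if "c \<in> M" for c
    proof -
      have "c \<in> {t1..t3}" "g c = w0" using that by (auto simp: M_def)
      with contg r(1) obtain d where "d > 0" "\<forall>s\<in>{t1..t3}. dist s c < d \<longrightarrow> dist (g s) w0 < r"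
        unfolding continuous_on_iff by metis
      then show ?thesis by (auto simp: dist_commute)
    qed
    obtain d1 where d1: "d1 > 0" "\<And>s. s \<in> {t1..t3} \<Longrightarrow> dist s a < d1 \<Longrightarrow> g s \<in> ball w0 r"
      using near[OF a(1)] by blast
    obtain d2 where d2: "d2 > 0" "\<And>s. s \<in> {t1..t3} \<Longrightarrow> dist s b < d2 \<Longrightarrow> g s \<in> ball w0 r"
      using near[OF b(1)] by blast
    define s' where "s' = max t1 (a - d1 / 2)"
    define s'' where "s'' = min t3 (b + d2 / 2)"
    have s': "s' \<in> {t1..t3}" "s' < a" "dist s' a < d1"
      using ab d1(1) by (auto simp: s'_def dist_real_def)
    have s'': "s'' \<in> {t1..t3}" "b < s''" "dist s'' b < d2"
      using ab d2(1) by (auto simp: s''_def dist_real_def)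
    have ne: "g s' \<noteq> w0" "g s'' \<noteq> w0"
      using s' s'' a(2)[of s'] b(2)[of s''] by (auto simp: M_def)
    have "closed_segment (g s') (g s'') \<subseteq> ball w0 r"
      using d1(2) d2(2) s' s'' by (intro closed_segment_subset convex_ball) auto
    then have "g a \<in> closed_segment (g s') (g s'')"
      using r s' s'' ab t by (intro shortest_curve_follows_chord[OF g]) auto
    then have "w0 \<in> open_segment (g s') (g s'')"
      using a(1) ne by (auto simp: M_def open_segment_def)
    from qc[OF _ _ this] have "min (\<psi> (g s')) (\<psi> (g s'')) < \<psi> w0"
      using gX s' s'' by blast
    with min[OF s'(1)] min[OF s''(1)] show False
      by (simp add: w0_def)
  qed
  with min have nonneg: "\<psi> (g s) \<ge> 0" if "s \<in> {t1..t3}" for s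
    using that by fastforce
  show ?thesis
  proof (cases "\<forall>s\<in>{t1..t3}. \<psi> (g s) = 0")
    case True
    with t show ?thesis by auto
  next
    case False
    then obtain s where s: "s \<in> {t1..t3}" "\<psi> (g s) > 0"
      using nonneg by force
    have ends: "g t1 \<in> U \<inter> X" "g t3 \<in> U \<inter> X"
      using gX t by auto
    have pos: "0 < \<psi> w" if "w \<in> open_segment (g t1) (g t3)" for w
      using qc[OF _ _ that] ends zero by simp
    have "w \<in> X" if "w \<in> open_segment (g t1) (g t3)" for w
    proof (rule side[OF gX[OF s(1)] s(2)])
      show "w \<in> U"
        using that ends closed_segment_subset[OF _ _ U, of "g t1" "g t3"] segment_open_subset_closed by blast
    qed (rule pos[OF that])
    then have "closed_segment (g t1) (g t3) \<subseteq> X"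
      using ends by (auto simp: closed_segment_eq_open)
    then have "g t2 \<in> closed_segment (g t1) (g t3)"
      using t by (intro shortest_curve_follows_chord[OF g]) auto
    \<comment> \<open>A zero of \<open>\<psi>\<close> on the chord must be one of its ends, and a
      curve that returns to a point has not moved meanwhile.\<close>
    moreover have "g t2 \<notin> open_segment (g t1) (g t3)"
      using pos[of "g t2"] zero by auto
    ultimately consider "g t1 = g t2" | "g t2 = g t3"
      by (auto simp: closed_segment_eq_open)
    then show ?thesis
    proof cases
      case 1
      have "\<psi> (g s) = 0" if "s \<in> {t1..t2}" for s
        using shortest_curve_constant[OF g _ _ 1 that] t zero by simp
      then show ?thesis by simp
    next
      case 2
      have "\<psi> (g s) = 0" if "s \<in> {t2..t3}" for s
        using shortest_curve_constant[OF g _ _ 2 that] t zero by simp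
      then show ?thesis by simp
    qed
  qed
qed

section \<open>Arcs of polynomial graphs\<close>

definition abscissa :: "real \<Rightarrow> real \<times> real \<Rightarrow> real" where
  "abscissa \<theta> z = fst z * cos \<theta> + snd z * sin \<theta>"

definition ordinate :: "real \<Rightarrow> real \<times> real \<Rightarrow> real" where
  "ordinate \<theta> z = - fst z * sin \<theta> + snd z * cos \<theta>"

definition graph_point :: "real poly \<Rightarrow> real \<Rightarrow> real \<Rightarrow> real \<times> real" where
  "graph_point p \<theta> t = (t * cos \<theta> - poly p t * sin \<theta>, t * sin \<theta> + poly p t * cos \<theta>)"

definition zero_curve :: "real poly \<Rightarrow> real \<Rightarrow> (real \<times> real) set" where
  "zero_curve p \<theta> = {z. Phi p \<theta> z = 0}"

lemma mem_zero_curve: "z \<in> zero_curve p \<theta> \<longleftrightarrow> Phi p \<theta> z = 0"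
  by (simp add: zero_curve_def)

lemma Phi_eq: "Phi p \<theta> z = poly p (abscissa \<theta> z) - ordinate \<theta> z"
  by (simp add: Phi_def abscissa_def ordinate_def)

lemma linear_abscissa: "linear (abscissa \<theta>)" and linear_ordinate: "linear (ordinate \<theta>)"
  unfolding abscissa_def ordinate_def by (auto intro!: linearI simp: algebra_simps)

lemma rotated_frame:
  "(abscissa \<theta> z * cos \<theta> - ordinate \<theta> z * sin \<theta>, abscissa \<theta> z * sin \<theta> + ordinate \<theta> z * cos \<theta>) = z"
proof -
  obtain x y where z: "z = (x, y)" by (cases z)
  have *: "cos \<theta> * cos \<theta> = 1 - sin \<theta> * sin \<theta>"
    using sin_cos_squared_add[of \<theta>] by (simp add: power2_eq_square)
  show ?thesis
    unfolding z abscissa_def ordinate_def by (simp add: algebra_simps *)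
qed

lemma abscissa_graph_point [simp]: "abscissa \<theta> (graph_point p \<theta> t) = t"
  and ordinate_graph_point [simp]: "ordinate \<theta> (graph_point p \<theta> t) = poly p t"
proof -
  have *: "cos \<theta> * cos \<theta> = 1 - sin \<theta> * sin \<theta>"
    using sin_cos_squared_add[of \<theta>] by (simp add: power2_eq_square)
  show "abscissa \<theta> (graph_point p \<theta> t) = t"
    unfolding graph_point_def abscissa_def by (simp add: algebra_simps *)
  show "ordinate \<theta> (graph_point p \<theta> t) = poly p t"
    unfolding graph_point_def ordinate_def fst_conv snd_conv using * by algebra
qed

lemma inj_graph_point: "inj (graph_point p \<theta>)"
  by (metis abscissa_graph_point injI)

lemma graph_point_abscissa: "z \<in> zero_curve p \<theta> \<Longrightarrow> graph_point p \<theta> (abscissa \<theta> z) = z"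
  using rotated_frame[of \<theta> z] unfolding graph_point_def by (simp add: mem_zero_curve Phi_eq)

lemma graph_point_in_zero_curve: "graph_point p \<theta> t \<in> zero_curve p \<theta>"
  by (simp add: mem_zero_curve Phi_eq)

lemma zero_curve_eq: "zero_curve p \<theta> = range (graph_point p \<theta>)"
  using graph_point_abscissa graph_point_in_zero_curve by (metis (no_types, lifting) image_iff rangeI set_eqI)

lemma continuous_on_abscissa: "continuous_on S (abscissa \<theta>)"
  unfolding abscissa_def by (intro continuous_intros)

lemma continuous_on_Phi: "continuous_on S (Phi p \<theta>)"
  unfolding Phi_def by (intro continuous_intros)

lemma continuous_on_graph_point: "continuous_on S (graph_point p \<theta>)"
  unfolding graph_point_def by (intro continuous_intros)

text \<open>Along the parametrised first curve, the function defining the second one is a polynomial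
  in the parameter. If it vanished identically, the first curve would be contained in the second;
  otherwise it has finitely many roots.\<close>

lemma finite_zero_curve_Int:
  assumes "\<not> zero_curve p \<theta> \<subseteq> zero_curve q \<phi>"
  shows "finite (zero_curve p \<theta> \<inter> zero_curve q \<phi>)"
proof -
  \<comment> \<open>The coefficients are the cosine and sine of \<phi> - \<theta> up to sign: the
    graph point is written in the frame turned by \<phi>.\<close>
  define r where "r = pcompose q ([:0, cos \<theta> * cos \<phi> + sin \<theta> * sin \<phi>:]
       + smult (cos \<theta> * sin \<phi> - sin \<theta> * cos \<phi>) p)
     - ([:0, sin \<theta> * cos \<phi> - cos \<theta> * sin \<phi>:] + smult (sin \<theta> * sin \<phi> + cos \<theta> * cos \<phi>) p)"
  have r: "poly r t = Phi q \<phi> (graph_point p \<theta> t)" for t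
    unfolding r_def Phi_def graph_point_def by (simp add: poly_pcompose algebra_simps)
  have "r \<noteq> 0"
  proof
    assume "r = 0"
    then have "Phi q \<phi> (graph_point p \<theta> t) = 0" for t
      using r[of t] by simp
    with assms show False
      unfolding zero_curve_eq[of p] by (auto simp: mem_zero_curve)
  qed
  then have "finite {t. poly r t = 0}"
    by (rule poly_roots_finite)
  moreover have "zero_curve p \<theta> \<inter> zero_curve q \<phi> \<subseteq> graph_point p \<theta> ` {t. poly r t = 0}"
    unfolding zero_curve_eq[of p] by (auto simp: mem_zero_curve r)
  ultimately show ?thesis
    by (meson finite_imageI finite_subset)
qed

section \<open>Strict convexity and strict quasiconcavity\<close>

lemma poly_strict_convex:
  fixes q :: "real poly"
  assumes C: "convex C" and pos: "\<And>x. x \<in> C \<Longrightarrow> poly (pderiv (pderiv q)) x > 0"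
    and ab: "a \<in> C" "b \<in> C" "a \<noteq> b" and l: "0 < l" "l < 1"
  shows "poly q ((1 - l) * a + l * b) < (1 - l) * poly q a + l * poly q b"
proof -
  have main: "poly q ((1 - l) * a + l * b) < (1 - l) * poly q a + l * poly q b"
    if ab: "a \<in> C" "b \<in> C" "a < b" and l: "0 < l" "l < 1" for a b l
  proof -
    define m where "m = (1 - l) * a + l * b"
    have m1: "m - a = l * (b - a)" and m2: "b - m = (1 - l) * (b - a)"
      by (simp_all add: m_def algebra_simps)
    have "a < m" "m < b"
      using m1 m2 ab l by (metis diff_gt_0_iff_gt mult_pos_pos)+
    then obtain x y where x: "a < x" "x < m" "poly q m - poly q a = (m - a) * poly (pderiv q) x"
      and y: "m < y" "y < b" "poly q b - poly q m = (b - m) * poly (pderiv q) y"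
      using poly_MVT[of a m q] poly_MVT[of m b q] by blast
    obtain z where z: "x < z" "z < y"
      "poly (pderiv q) y - poly (pderiv q) x = (y - x) * poly (pderiv (pderiv q)) z"
      using poly_MVT[of x y "pderiv q"] x y by auto
    have "z \<in> {a..b}" using x y z by auto
    moreover have "{a..b} \<subseteq> C"
      using C ab closed_segment_subset[OF _ _ C, of a b] by (simp add: closed_segment_eq_real_ivl)
    ultimately have "poly (pderiv (pderiv q)) z > 0"
      using pos by blast
    then have "0 < poly (pderiv q) y - poly (pderiv q) x"
      using z x y by simp
    \<comment> \<open>The mean slopes on the two sides of \<open>m\<close> are
      \<open>poly (pderiv q)\<close> at \<open>x\<close> and \<open>y\<close>. The factor clears the
      denominators of both difference quotients, as the two parts have lengths
      \<open>l * (b - a)\<close> and \<open>(1 - l) * (b - a)\<close>.\<close>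
    then have "0 < l * (1 - l) * (b - a) * (poly (pderiv q) y - poly (pderiv q) x)"
      using ab l by (intro mult_pos_pos) auto
    also have "\<dots> = l * (poly q b - poly q m) - (1 - l) * (poly q m - poly q a)"
      unfolding x(3) y(3) m1 m2 by (simp add: algebra_simps)
    finally show ?thesis
      unfolding m_def[symmetric] by (simp add: algebra_simps)
  qed
  show ?thesis
  proof (cases "a < b")
    case True
    with main ab l show ?thesis by blast
  next
    case False
    with ab main[of b a "1 - l"] l show ?thesis by (simp add: algebra_simps)
  qed
qed

text \<open>Convexity of \<open>q\<close> yields a strict inequality only if the abscissas differ.
  On lines of constant abscissa \<open>\<psi>\<close> is affine, so strict concavity fails; but it
  is not constant there because \<open>c\<close> is nonzero, and strict quasiconcavity
  survives.\<close>

lemma strip_strict_quasiconcave: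
  fixes q :: "real poly"
  assumes C: "convex C" and pos: "\<And>x. x \<in> C \<Longrightarrow> poly (pderiv (pderiv q)) x > 0"
    and PQ: "abscissa \<theta> P \<in> C" "abscissa \<theta> Q \<in> C" and w: "w \<in> open_segment P Q" and "c \<noteq> 0"
  defines "\<psi> \<equiv> \<lambda>z. c * ordinate \<theta> z - poly q (abscissa \<theta> z)"
  shows "min (\<psi> P) (\<psi> Q) < \<psi> w"
proof -
  obtain l where l: "0 < l" "l < 1" "w = (1 - l) *\<^sub>R P + l *\<^sub>R Q" and "P \<noteq> Q"
    using w by (auto simp: in_segment)
  have a: "abscissa \<theta> w = (1 - l) * abscissa \<theta> P + l * abscissa \<theta> Q"
    and o: "ordinate \<theta> w = (1 - l) * ordinate \<theta> P + l * ordinate \<theta> Q"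
    unfolding l(3) using linear_abscissa[of \<theta>] linear_ordinate[of \<theta>]
    by (simp_all add: linear_add linear_scale)
  have mix: "min u v \<le> (1 - l) * u + l * v" "u \<noteq> v \<Longrightarrow> min u v < (1 - l) * u + l * v" for u v :: real
  proof -
    have *: "(1 - l) * u + l * v = u + l * (v - u)" "(1 - l) * u + l * v = v + (1 - l) * (u - v)"
      by (simp_all add: algebra_simps)
    show "u \<noteq> v \<Longrightarrow> min u v < (1 - l) * u + l * v"
    proof (cases "u < v")
      case True
      then have "0 < l * (v - u)" using l by simp
      with True show ?thesis unfolding * by linarith
    next
      case False
      moreover assume "u \<noteq> v"
      ultimately have "0 < (1 - l) * (u - v)" using l by simp
      with False show ?thesis unfolding *(2) by linarith
    qed
    then show "min u v \<le> (1 - l) * u + l * v"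
      by (cases "u = v") (auto simp: algebra_simps)
  qed
  show ?thesis
  proof (cases "abscissa \<theta> P = abscissa \<theta> Q")
    case True
    with \<open>P \<noteq> Q\<close> have "ordinate \<theta> P \<noteq> ordinate \<theta> Q"
      using rotated_frame by metis
    with True \<open>c \<noteq> 0\<close> have "\<psi> P \<noteq> \<psi> Q"
      by (simp add: \<psi>_def)
    moreover have "\<psi> w = (1 - l) * \<psi> P + l * \<psi> Q"
      unfolding \<psi>_def a o True by (simp add: algebra_simps)
    ultimately show ?thesis using mix(2) by simp
  next
    case False
    from poly_strict_convex[OF C pos PQ False l(1,2)]
    have "(1 - l) * \<psi> P + l * \<psi> Q < \<psi> w"
      unfolding \<psi>_def a o by (simp add: algebra_simps)
    with mix(1)[of "\<psi> P" "\<psi> Q"] show ?thesis by linarith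
  qed
qed

text \<open>If \<open>h s\<close> exceeded both end values, the larger of them would be taken again
  beyond \<open>s\<close>, and \<open>h\<close> would have to be constant on an interval containing
  \<open>s\<close>.\<close>

lemma le_max_endpoints_of_connected_fibres:
  fixes h :: "real \<Rightarrow> real"
  assumes cont: "continuous_on {s1..s2} h"
    and const: "\<And>x y u. x \<in> {s1..s2} \<Longrightarrow> y \<in> {s1..s2} \<Longrightarrow> h x = h y \<Longrightarrow> u \<in> {x..y} \<Longrightarrow> h u = h x"
    and s: "s \<in> {s1..s2}"
  shows "h s \<le> max (h s1) (h s2)"
proof (rule ccontr)
  assume "\<not> ?thesis"
  then have gt: "h s1 < h s" "h s2 < h s" by auto
  have c1: "continuous_on {s1..s} h" and c2: "continuous_on {s..s2} h"
    using cont s by (auto elim: continuous_on_subset)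
  show False
  proof (cases "h s2 \<le> h s1")
    case True
    obtain x where "s \<le> x" "x \<le> s2" "h x = h s1"
      using IVT2'[of h s2 "h s1" s] gt True c2 s by auto
    with const[of s1 x s] s gt show False by auto
  next
    case False
    obtain x where "s1 \<le> x" "x \<le> s" "h x = h s2"
      using IVT'[of h s1 "h s2" s] gt False c1 s by auto
    with const[of x s2 s] s gt show False by auto
  qed
qed

text \<open>Being on the graph does not yet mean being on the arc. But the abscissa cannot overshoot
  and return, since a repeated value forces the curve to rest; applied to \<open>h\<close> and
  \<open>- h\<close>, this bounds the abscissa by its end values.\<close>

lemma shortest_curve_along_graph:
  assumes g: "shortest_curve X A B g" and s: "0 \<le> s1" "s1 \<le> s2" "s2 \<le> 1"
    and on: "g ` {s1..s2} \<subseteq> zero_curve p \<theta>"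
    and ends: "g s1 \<in> graph_point p \<theta> ` {a<..<b}" "g s2 \<in> graph_point p \<theta> ` {a<..<b}"
    and u: "u \<in> {s1..s2}"
  shows "g u \<in> graph_point p \<theta> ` {a<..<b}"
proof -
  define h where "h t = abscissa \<theta> (g t)" for t
  have h: "g t = graph_point p \<theta> (h t)" if "t \<in> {s1..s2}" for t
    using on that graph_point_abscissa unfolding h_def by (metis image_subset_iff)
  have "continuous_on {s1..s2} g"
    using shortest_curve_continuous[OF g] s by (auto elim: continuous_on_subset)
  then have cont: "continuous_on {s1..s2} h"
    unfolding h_def by (rule continuous_on_compose2[OF continuous_on_abscissa[of UNIV]]) auto
  have const: "h t = h x" if xy: "x \<in> {s1..s2}" "y \<in> {s1..s2}" "h x = h y" "t \<in> {x..y}" for x y t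
  proof -
    have "g x = g y" using h xy by metis
    then have "g t = g x"
      using shortest_curve_constant[OF g, of x y t] xy s by auto
    then show ?thesis by (simp add: h_def)
  qed
  have "h u \<le> max (h s1) (h s2)"
    by (rule le_max_endpoints_of_connected_fibres[OF cont _ u]) (rule const)
  moreover have "- h u \<le> max (- h s1) (- h s2)"
  proof (rule le_max_endpoints_of_connected_fibres[OF continuous_on_minus[OF cont] _ u])
    fix x y t assume "x \<in> {s1..s2}" "y \<in> {s1..s2}" "- h x = - h y" "t \<in> {x..y}"
    then show "- h t = - h x" using const[of x y t] by simp
  qed
  moreover have "h s1 \<in> {a<..<b}" "h s2 \<in> {a<..<b}"
    using ends unfolding h_def by auto
  ultimately have "h u \<in> {a<..<b}" by auto
  with h[OF u] show ?thesis by simp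
qed

section \<open>Boundary arcs of an intersection of half planes\<close>

definition halfplane_region :: "(real poly \<times> real) set \<Rightarrow> (real \<times> real) set" where
  "halfplane_region P = {z. \<forall>(q, \<phi>)\<in>P. Phi q \<phi> z \<ge> 0}"

lemma open_Phi_pos:
  assumes "finite P"
  shows "open {z. \<forall>(q, \<phi>)\<in>P. Phi q \<phi> z > 0}"
proof -
  have "{z. \<forall>(q, \<phi>)\<in>P. Phi q \<phi> z > 0} = (\<Inter>(q, \<phi>)\<in>P. {z. 0 < Phi q \<phi> z})"
    by auto
  moreover have "open {z. 0 < Phi q \<phi> z}" for q \<phi>
    by (intro open_Collect_less continuous_on_const continuous_on_Phi)
  ultimately show ?thesis
    using assms by (auto intro!: open_INT)
qed

text \<open>By \<open>isol\<close>, near the closed arc only half planes bounded by this very curve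
  matter, though possibly on either side. There the local analysis reduces to
  \<open>shortest_curve_no_double_touch\<close> with \<open>\<psi>\<close> a multiple of
  \<open>Phi p \<theta>\<close>.\<close>

lemma curved_arc_interacts_finitely:
  assumes P: "finite P" and g: "shortest_curve (halfplane_region P) A B g" and "a < b"
    and curved: "\<And>t. t \<in> {a..b} \<Longrightarrow> poly (pderiv (pderiv p)) t \<noteq> 0"
    and isol: "\<And>t q \<phi>. t \<in> {a..b} \<Longrightarrow> (q, \<phi>) \<in> P \<Longrightarrow>
       zero_curve q \<phi> = zero_curve p \<theta> \<or> Phi q \<phi> (graph_point p \<theta> t) > 0"
  shows "interacts_finitely g (graph_point p \<theta> ` {a<..<b})"
  unfolding interacts_finitely_def
proof (rule finite_components_locally_two[OF compact_Icc])
  let ?X = "halfplane_region P"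
  let ?c = "graph_point p \<theta>"
  let ?Z = "zero_curve p \<theta>"
  let ?T = "{t \<in> {0..1}. g t \<in> ?c ` {a<..<b}}"
  show "?T \<subseteq> {0..1}" by auto
  fix t :: real assume t: "t \<in> {0..1}"
  have contg: "continuous_on {0..1} g"
    by (rule shortest_curve_continuous[OF g])
  have near: "\<exists>d>0. \<forall>s\<in>{0..1}. dist s t < d \<longrightarrow> g s \<in> S" if S: "open S" "g t \<in> S" for S
  proof -
    obtain r where r: "r > 0" "ball (g t) r \<subseteq> S"
      using S open_contains_ball by blast
    obtain d where "d > 0" "\<forall>s\<in>{0..1}. dist s t < d \<longrightarrow> dist (g s) (g t) < r"
      using contg t r(1) unfolding continuous_on_iff by blast
    with r(2) show ?thesis by (intro exI[of _ d]) (auto simp: dist_commute)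
  qed
  show "\<exists>V. open V \<and> t \<in> V \<and> (\<forall>t1\<in>?T \<inter> V. \<forall>t2\<in>?T \<inter> V. \<forall>t3\<in>?T \<inter> V.
    t1 < t2 \<longrightarrow> t2 < t3 \<longrightarrow> {t1..t2} \<subseteq> ?T \<or> {t2..t3} \<subseteq> ?T)"
  \<comment> \<open>The split uses the closed arc: times at the end points of the arc are not in
    \<open>?T\<close> but can be limits of it, so they need the full argument.\<close>
  proof (cases "g t \<in> ?c ` {a..b}")
    case False
    have "compact (?c ` {a..b})"
      by (intro compact_continuous_image continuous_on_graph_point compact_Icc)
    then have "open (- ?c ` {a..b})"
      by (simp add: compact_imp_closed open_Compl)
    from near[OF this] False obtain d where d: "d > 0"
      "\<And>s. s \<in> {0..1} \<Longrightarrow> dist s t < d \<Longrightarrow> g s \<notin> ?c ` {a..b}" by auto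
    have "?T \<inter> ball t d = {}"
    proof (rule ccontr)
      assume "?T \<inter> ball t d \<noteq> {}"
      then obtain s where "s \<in> ?T \<inter> ball t d" by blast
      then have s: "s \<in> {0..1}" "dist s t < d" "g s \<in> ?c ` {a<..<b}"
        by (simp_all add: dist_commute)
      moreover have "?c ` {a<..<b} \<subseteq> ?c ` {a..b}" by (intro image_mono) auto
      ultimately show False using d(2)[OF s(1,2)] by blast
    qed
    with d show ?thesis by (intro exI[of _ "ball t d"]) auto
  next
    case True
    then obtain t0 where t0: "t0 \<in> {a..b}" "g t = ?c t0" by blast
    \<comment> \<open>The sign turns \<open>p\<close> into a polynomial \<open>q\<close> that is
      convex near \<open>t0\<close>, treating both directions of bending at once.\<close>
    define \<sigma> where "\<sigma> = sgn (poly (pderiv (pderiv p)) t0)"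
    have \<sigma>: "\<sigma> \<noteq> 0" "\<sigma> * poly (pderiv (pderiv p)) t0 > 0"
      using curved[OF t0(1)] by (auto simp: \<sigma>_def sgn_real_def)
    define q where "q = smult \<sigma> p"
    have q: "poly (pderiv (pderiv q)) x = \<sigma> * poly (pderiv (pderiv p)) x" for x
      by (simp add: q_def pderiv_smult)
    define P' where "P' = {(r, \<phi>) \<in> P. zero_curve r \<phi> \<noteq> ?Z}"
    have "finite P'" using P by (rule rev_finite_subset) (auto simp: P'_def)
    \<comment> \<open>Here \<open>q\<close> is strictly convex and the half planes with other
      boundary curves impose no constraint. A ball in \<open>S\<close> is convex, and so is its set
      of abscissas.\<close>
    define S where "S = {z. 0 < poly (pderiv (pderiv q)) (abscissa \<theta> z)} \<inter> {z. \<forall>(r, \<phi>)\<in>P'. Phi r \<phi> z > 0}"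
    have "continuous_on UNIV (\<lambda>z. poly (pderiv (pderiv q)) (abscissa \<theta> z))"
      by (intro continuous_on_poly continuous_on_abscissa)
    then have "open S"
      unfolding S_def using open_Phi_pos[OF \<open>finite P'\<close>]
      by (intro open_Int open_Collect_less continuous_on_const) auto
    moreover have "g t \<in> S"
      unfolding S_def using isol[OF t0(1)] \<sigma> by (auto simp: t0(2) q P'_def)
    ultimately obtain r where r: "r > 0" "ball (g t) r \<subseteq> S"
      using open_contains_ball by blast
    define U where "U = ball (g t) r"
    have U: "U \<subseteq> S" "convex U" using r by (auto simp: U_def)
    define \<psi> where "\<psi> z = \<sigma> * ordinate \<theta> z - poly q (abscissa \<theta> z)" for z
    have \<psi>: "\<psi> z = - \<sigma> * Phi p \<theta> z" for z
      by (simp add: \<psi>_def q_def Phi_eq algebra_simps)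
    have zero: "\<psi> z = 0 \<longleftrightarrow> z \<in> ?Z" for z
      using \<sigma>(1) by (simp add: \<psi> mem_zero_curve)
    have qc: "min (\<psi> R) (\<psi> Q) < \<psi> w" if "R \<in> U" "Q \<in> U" "w \<in> open_segment R Q" for R Q w
      unfolding \<psi>_def
    proof (rule strip_strict_quasiconcave[of "abscissa \<theta> ` U"])
      show "convex (abscissa \<theta> ` U)"
        by (rule convex_linear_image[OF linear_abscissa U(2)])
      show "0 < poly (pderiv (pderiv q)) x" if "x \<in> abscissa \<theta> ` U" for x
        using that U(1) by (auto simp: S_def)
    qed (use that \<sigma> in auto)
    have posU: "Phi r \<phi> w > 0" if "(r, \<phi>) \<in> P" "zero_curve r \<phi> \<noteq> ?Z" "w \<in> U" for r \<phi> w
    proof -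
      have "(r, \<phi>) \<in> P'" using that by (simp add: P'_def)
      moreover have "w \<in> S" using that U(1) by blast
      ultimately show ?thesis by (auto simp: S_def)
    qed
    have intr: "w \<in> interior ?X" if w: "w \<in> U \<inter> ?X" "\<psi> w \<noteq> 0" for w
    proof (rule interiorI)
      show "open {z. \<forall>(r, \<phi>)\<in>P. Phi r \<phi> z > 0}" by (rule open_Phi_pos[OF P])
      show "{z. \<forall>(r, \<phi>)\<in>P. Phi r \<phi> z > 0} \<subseteq> ?X"
        by (force simp: halfplane_region_def)
      have "Phi r \<phi> w > 0" if "(r, \<phi>) \<in> P" for r \<phi>
      proof (cases "zero_curve r \<phi> = ?Z")
        case True
        then have "Phi r \<phi> w \<noteq> 0" using w(2) zero[of w] by (auto simp: mem_zero_curve)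
        moreover have "Phi r \<phi> w \<ge> 0" using w(1) that by (auto simp: halfplane_region_def)
        ultimately show ?thesis by simp
      next
        case False
        with that w(1) show ?thesis by (intro posU) auto
      qed
      then show "w \<in> {z. \<forall>(r, \<phi>)\<in>P. Phi r \<phi> z > 0}" by auto
    qed
    have side: "z \<in> ?X" if w: "w \<in> U \<inter> ?X" "0 < \<psi> w" and z: "z \<in> U" "0 < \<psi> z" for w z
    proof -
      \<comment> \<open>By quasiconcavity the segment from \<open>w\<close> to \<open>z\<close>
        avoids the curve. A half plane with this boundary curve contains \<open>w\<close>, and its
        function cannot change sign along the segment, so it contains \<open>z\<close>; no relation
        between the two defining functions is required.\<close>
      have pos: "0 < \<psi> y" if "y \<in> closed_segment w z" for y
        using that qc[of w z y] w z by (cases "y = w \<or> y = z") (auto simp: open_segment_def)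
      have "Phi r \<phi> z \<ge> 0" if "(r, \<phi>) \<in> P" for r \<phi>
      proof (cases "zero_curve r \<phi> = ?Z")
        case True
        have "Phi r \<phi> w \<ge> 0" using w(1) that by (auto simp: halfplane_region_def)
        show ?thesis
        proof (rule ccontr)
          assume "\<not> Phi r \<phi> z \<ge> 0"
          have "connected (Phi r \<phi> ` closed_segment w z)"
            by (intro connected_continuous_image continuous_on_Phi connected_segment)
          moreover have "Phi r \<phi> z \<in> Phi r \<phi> ` closed_segment w z" "Phi r \<phi> w \<in> Phi r \<phi> ` closed_segment w z"
            by auto
          ultimately have "{Phi r \<phi> z..Phi r \<phi> w} \<subseteq> Phi r \<phi> ` closed_segment w z"
            by (rule connected_contains_Icc)
          then have "0 \<in> Phi r \<phi> ` closed_segment w z"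
            using \<open>Phi r \<phi> w \<ge> 0\<close> \<open>\<not> Phi r \<phi> z \<ge> 0\<close> by (meson atLeastAtMost_iff linear subsetD)
          then obtain y where "y \<in> closed_segment w z" "y \<in> zero_curve r \<phi>"
            by (auto simp: mem_zero_curve)
          then show False using pos[of y] zero[of y] True by simp
        qed
      next
        case False
        with that z(1) show ?thesis by (intro less_imp_le posU) auto
      qed
      then show ?thesis by (auto simp: halfplane_region_def)
    qed
    have "open U" "g t \<in> U" using r by (auto simp: U_def)
    from near[OF this] obtain d where d: "d > 0" "\<And>s. s \<in> {0..1} \<Longrightarrow> dist s t < d \<Longrightarrow> g s \<in> U" by blast
    have "{t1..t2} \<subseteq> ?T \<or> {t2..t3} \<subseteq> ?T"
      if T: "t1 \<in> ?T \<inter> ball t d" "t2 \<in> ?T \<inter> ball t d" "t3 \<in> ?T \<inter> ball t d" and lt: "t1 < t2" "t2 < t3" for t1 t2 t3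
    proof -
      have "g ` {t1..t3} \<subseteq> U"
      proof (rule image_subsetI)
        fix s assume "s \<in> {t1..t3}"
        with T show "g s \<in> U" by (intro d(2)) (auto simp: dist_real_def)
      qed
      moreover have *: "\<psi> (g s) = 0" if "s \<in> ?T" for s
        using that graph_point_in_zero_curve zero by auto
      moreover have "continuous_on U \<psi>"
        unfolding \<psi> by (intro continuous_intros continuous_on_Phi)
      ultimately have "(\<forall>s\<in>{t1..t2}. \<psi> (g s) = 0) \<or> (\<forall>s\<in>{t2..t3}. \<psi> (g s) = 0)"
        using T lt
        by (intro shortest_curve_no_double_touch[OF g U(2) _ qc intr side]) auto
      \<comment> \<open>Zeros of \<open>\<psi>\<close> only keep the curve on the whole graph; that
        it stays within the arc comes from its monotone motion along the graph.\<close>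
      moreover have "{s1..s2} \<subseteq> ?T" if s: "s1 \<in> ?T" "s2 \<in> ?T" "s1 < s2" "\<forall>s\<in>{s1..s2}. \<psi> (g s) = 0" for s1 s2
      proof
        fix u assume u: "u \<in> {s1..s2}"
        have "g u \<in> ?c ` {a<..<b}"
          by (rule shortest_curve_along_graph[OF g _ _ _ _ _ _ u]) (use s zero in auto)
        with u s show "u \<in> ?T" by auto
      qed
      ultimately show ?thesis using T lt by blast
    qed
    with d show ?thesis by (intro exI[of _ "ball t d"]) auto
  qed
qed

text \<open>Straight edges are out of reach of the curvature argument, but their arcs are convex
  cells, being affine images of intervals.\<close>

lemma convex_graph_of_affine:
  assumes "pderiv (pderiv p) = 0" "convex S"
  shows "convex (graph_point p \<theta> ` S)"
proof -
  obtain c where c: "pderiv p = [:c:]"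
    using assms(1) by (metis pderiv_eq_0_iff degree_eq_zeroE)
  have p: "poly p t = poly p 0 + t * c" for t
    using poly_MVT[of 0 t p] poly_MVT[of t 0 p] by (cases t "0::real" rule: linorder_cases) (auto simp: c)
  let ?l = "\<lambda>t::real. t *\<^sub>R (cos \<theta> - c * sin \<theta>, sin \<theta> + c * cos \<theta>)"
  have "graph_point p \<theta> t = graph_point p \<theta> 0 + ?l t" for t
    unfolding graph_point_def by (subst (1 2) p) (simp add: algebra_simps)
  then have "graph_point p \<theta> ` S = (+) (graph_point p \<theta> 0) ` ?l ` S"
    unfolding image_image by (rule image_cong[OF refl])
  moreover have "linear ?l"
    by (intro linearI) (simp_all add: algebra_simps)
  ultimately show ?thesis
    using assms(2) by (metis convex_linear_image convex_translation)
qed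

lemma tame_graph_arcs:
  assumes P: "finite P" and W: "open W"
    and curved: "pderiv (pderiv p) = 0 \<or> (\<forall>t\<in>W. poly (pderiv (pderiv p)) t \<noteq> 0)"
    and isol: "\<And>t q \<phi>. t \<in> W \<Longrightarrow> (q, \<phi>) \<in> P \<Longrightarrow>
       zero_curve q \<phi> = zero_curve p \<theta> \<or> Phi q \<phi> (graph_point p \<theta> t) > 0"
  shows "tame (halfplane_region P) (graph_point p \<theta> ` W)"
proof -
  let ?c = "graph_point p \<theta>"
  obtain D where D: "countable D" "\<Union>D = W" "pairwise disjnt D"
    and cell: "\<And>e. e \<in> D \<Longrightarrow> (\<exists>x. e = {x}) \<or> (\<exists>a b. a < b \<and> {a..b} \<subseteq> W \<and> e = {a<..<b})"
    using open_real_interval_partition[OF W] by blast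
  have sub: "?c ` W \<subseteq> halfplane_region P"
  proof (rule image_subsetI)
    fix t assume "t \<in> W"
    have "Phi q \<phi> (?c t) \<ge> 0" if "(q, \<phi>) \<in> P" for q \<phi>
      using isol[OF \<open>t \<in> W\<close> that] graph_point_in_zero_curve[of p \<theta> t]
      by (metis less_eq_real_def mem_zero_curve)
    then show "?c t \<in> halfplane_region P" by (auto simp: halfplane_region_def)
  qed
  have "is_cell (?c ` e)" if "e \<in> D" for e
    using cell[OF that]
  proof (elim disjE exE conjE)
    fix a b assume ab: "a < b" "e = {a<..<b}"
    have "?c ` e homeomorphic e"
      by (rule homeomorphicI[where f = "abscissa \<theta>" and g = ?c])
        (auto simp: image_image continuous_on_abscissa continuous_on_graph_point)
    also have "e homeomorphic (UNIV :: real set)"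
      using ab by (auto intro: homeomorphic_open_interval_UNIV)
    finally show ?thesis by (simp add: is_cell_def)
  qed (auto simp: is_cell_def)
  moreover have "?c ` e1 \<inter> ?c ` e2 = {}" if "e1 \<in> D" "e2 \<in> D" "?c ` e1 \<noteq> ?c ` e2" for e1 e2
  proof -
    have "e1 \<inter> e2 = {}"
      using D(3) that by (auto simp: pairwise_def disjnt_def)
    then show ?thesis
      using image_Int[OF inj_graph_point] by (metis image_empty)
  qed
  moreover have "\<Union>((`) ?c ` D) = ?c ` W"
    using D(2) by blast
  ultimately have dec: "cell_decomposition (?c ` W) ((`) ?c ` D)"
    unfolding cell_decomposition_def using D(1) by auto
  have "interacts_finitely g (?c ` e)" if g: "shortest_curve (halfplane_region P) A B g" and e: "e \<in> D" for A B g e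
  proof -
    have eW: "?c ` e \<subseteq> halfplane_region P" using e D(2) sub by blast
    from cell[OF e] consider x where "e = {x}" | a b where "a < b" "{a..b} \<subseteq> W" "e = {a<..<b}" by blast
    then show ?thesis
    proof cases
      case 1
      then show ?thesis by (intro convex_interacts_finitely[OF g _ eW]) auto
    next
      case 2
      show ?thesis
      proof (cases "pderiv (pderiv p) = 0")
        case True
        then have "convex (?c ` e)"
          unfolding 2(3) by (rule convex_graph_of_affine) (rule convex_real_interval)
        then show ?thesis by (rule convex_interacts_finitely[OF g _ eW])
      next
        case False
        show ?thesis
          unfolding 2(3)
          by (rule curved_arc_interacts_finitely[OF P g 2(1)]) (use curved False isol 2(2) in blast)+
      qed
    qed
  qed
  with dec show ?thesis
    unfolding tame_def by (intro exI[of _ "(`) ?c ` D"]) auto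
qed

text \<open>On the part of the curve in \<open>X\<close> outside \<open>F\<close>, every half plane
  with another boundary curve is strictly positive. Strict positivity is an open condition, so the
  parameters of this part form an open set, as \<open>tame_graph_arcs\<close> requires.\<close>

lemma tame_zero_curve_part:
  assumes P: "finite P" and F: "finite F"
    and isol: "\<And>q \<phi>. (q, \<phi>) \<in> P \<Longrightarrow> zero_curve q \<phi> \<noteq> zero_curve p \<theta> \<Longrightarrow> zero_curve p \<theta> \<inter> zero_curve q \<phi> \<subseteq> F"
  shows "tame (halfplane_region P) (zero_curve p \<theta> \<inter> halfplane_region P - F)"
proof -
  let ?c = "graph_point p \<theta>"
  define P' where "P' = {(r, \<phi>) \<in> P. zero_curve r \<phi> \<noteq> zero_curve p \<theta>}"
  have "finite P'" using P by (rule rev_finite_subset) (auto simp: P'_def)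
  define W where "W = ?c -` ({z. \<forall>(r, \<phi>)\<in>P'. Phi r \<phi> z > 0} - F)"
  have "open W"
    unfolding W_def using F open_Phi_pos[OF \<open>finite P'\<close>] continuous_on_graph_point
    by (intro open_vimage open_Diff) (auto simp: finite_imp_closed)
  have W: "zero_curve p \<theta> \<inter> halfplane_region P - F = ?c ` W"
  proof (rule set_eqI)
    fix z
    show "z \<in> zero_curve p \<theta> \<inter> halfplane_region P - F \<longleftrightarrow> z \<in> ?c ` W"
    proof
      assume z: "z \<in> zero_curve p \<theta> \<inter> halfplane_region P - F"
      have "Phi r \<phi> z > 0" if "(r, \<phi>) \<in> P'" for r \<phi>
      proof -
        have "(r, \<phi>) \<in> P" "z \<notin> zero_curve r \<phi>"
          using that isol[of r \<phi>] z by (auto simp: P'_def)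
        moreover have "Phi r \<phi> z \<ge> 0"
          using calculation z by (auto simp: halfplane_region_def)
        ultimately show ?thesis by (auto simp: mem_zero_curve)
      qed
      moreover have zc: "z = ?c (abscissa \<theta> z)"
        using graph_point_abscissa z by simp
      ultimately have "abscissa \<theta> z \<in> W"
        using z by (auto simp: W_def)
      with zc show "z \<in> ?c ` W" by blast
    next
      assume "z \<in> ?c ` W"
      then obtain t where t: "t \<in> W" "z = ?c t" by blast
      have "Phi r \<phi> z \<ge> 0" if "(r, \<phi>) \<in> P" for r \<phi>
      proof (cases "zero_curve r \<phi> = zero_curve p \<theta>")
        case True
        then show ?thesis
          using graph_point_in_zero_curve[of p \<theta> t] t by (metis mem_zero_curve order_refl)
      next
        case False
        with that t show ?thesis by (force simp: W_def P'_def)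
      qed
      with t show "z \<in> zero_curve p \<theta> \<inter> halfplane_region P - F"
        using graph_point_in_zero_curve[of p \<theta> t] by (auto simp: W_def halfplane_region_def)
    qed
  qed
  \<comment> \<open>The parameters excluded for curvature. If the second derivative vanishes
    identically, every parameter would be a root, so this case is kept apart to keep
    \<open>G\<close> finite.\<close>
  define G where "G = (if pderiv (pderiv p) = 0 then {} else {t. poly (pderiv (pderiv p)) t = 0})"
  have G: "finite G"
    unfolding G_def using poly_roots_finite by auto
  have "tame (halfplane_region P) (?c ` (W - G))"
  proof (rule tame_graph_arcs[OF P])
    show "open (W - G)"
      using \<open>open W\<close> G by (intro open_Diff finite_imp_closed)
    show "pderiv (pderiv p) = 0 \<or> (\<forall>t\<in>W - G. poly (pderiv (pderiv p)) t \<noteq> 0)"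
      by (auto simp: G_def)
    show "zero_curve q \<phi> = zero_curve p \<theta> \<or> 0 < Phi q \<phi> (?c t)" if "t \<in> W - G" "(q, \<phi>) \<in> P" for t q \<phi>
      using that by (auto simp: W_def P'_def)
  qed
  moreover have "tame (halfplane_region P) (?c ` (W \<inter> G))"
    using G W by (intro tame_countable countable_finite) auto
  moreover have "disjnt (?c ` (W - G)) (?c ` (W \<inter> G))"
    unfolding disjnt_def image_Int[OF inj_graph_point, symmetric] by blast
  ultimately have "tame (halfplane_region P) (?c ` (W - G) \<union> ?c ` (W \<inter> G))"
    by (rule tame_Un)
  moreover have "?c ` (W - G) \<union> ?c ` (W \<inter> G) = ?c ` W" by blast
  ultimately show ?thesis unfolding W by simp
qed

section \<open>Assembly of the decomposition\<close>

lemma tame_halfplane_region: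
  assumes P: "finite P"
  shows "tame (halfplane_region P) (halfplane_region P)"
proof -
  let ?X = "halfplane_region P"
  define \<Z> where "\<Z> = (\<lambda>(p, \<theta>). zero_curve p \<theta>) ` P"
  \<comment> \<open>Finiteness of an intersection needs a non-inclusion of the first curve in the
    second. Choosing curves maximal for inclusion supplies it without comparing their polynomials,
    and every other curve is contained in a maximal one. Pairs with the same curve are already
    merged in \<open>\<Z>\<close>.\<close>
  define \<M> where "\<M> = {Z \<in> \<Z>. \<forall>Z'\<in>\<Z>. Z \<subseteq> Z' \<longrightarrow> Z = Z'}"
  define F where "F = (\<Union>Z\<in>\<M>. \<Union>Z'\<in>\<Z> - {Z}. Z \<inter> Z')"
  have "finite \<Z>" using P by (simp add: \<Z>_def)
  have "finite \<M>" using \<open>finite \<Z>\<close> by (simp add: \<M>_def)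
  have F: "finite F"
    unfolding F_def
  proof (intro finite_UN_I)
    fix Z Z' assume Z: "Z \<in> \<M>" "Z' \<in> \<Z> - {Z}"
    then have "\<not> Z \<subseteq> Z'" by (auto simp: \<M>_def)
    moreover obtain p \<theta> q \<phi> where "Z = zero_curve p \<theta>" "Z' = zero_curve q \<phi>"
      using Z by (auto simp: \<M>_def \<Z>_def)
    ultimately show "finite (Z \<inter> Z')"
      using finite_zero_curve_Int by blast
  qed (use \<open>finite \<M>\<close> \<open>finite \<Z>\<close> in auto)
  define O' where "O' = {z. \<forall>(q, \<phi>)\<in>P. Phi q \<phi> z > 0}"
  define \<Y> where "\<Y> = insert O' (insert (F \<inter> ?X) ((\<lambda>Z. Z \<inter> ?X - F) ` \<M>))"
  have O': "O' \<inter> Z = {}" if "Z \<in> \<Z>" for Z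
    using that by (force simp: O'_def \<Z>_def mem_zero_curve)
  have OX: "O' \<subseteq> ?X"
    by (force simp: O'_def halfplane_region_def)
  have OF: "O' \<inter> F = {}"
    using O' by (fastforce simp: F_def \<M>_def)
  have "tame ?X (\<Union>\<Y>)"
  proof (rule tame_Union)
    show "countable \<Y>"
      using \<open>finite \<M>\<close> by (simp add: \<Y>_def countable_finite)
    have "disjnt (Z \<inter> ?X - F) (Z' \<inter> ?X - F)" if "Z \<in> \<M>" "Z' \<in> \<M>" "Z \<noteq> Z'" for Z Z'
    proof -
      have "Z \<inter> Z' \<subseteq> F"
        using that unfolding F_def \<M>_def by blast
      then show ?thesis by (auto simp: disjnt_def)
    qed
    moreover have "disjnt O' (Z \<inter> ?X - F)" if "Z \<in> \<M>" for Z
      using O'[of Z] that by (auto simp: disjnt_def \<M>_def)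
    moreover have "disjnt O' (F \<inter> ?X)"
      using OF by (auto simp: disjnt_def)
    ultimately show "pairwise disjnt \<Y>"
      unfolding \<Y>_def by (auto simp: pairwise_insert pairwise_image disjnt_sym pairwise_def) (auto simp: disjnt_def)
    fix Y assume "Y \<in> \<Y>"
    then consider "Y = O'" | "Y = F \<inter> ?X" | Z where "Z \<in> \<M>" "Y = Z \<inter> ?X - F"
      by (auto simp: \<Y>_def)
    then show "tame ?X Y"
    proof cases
      case 1
      then show ?thesis using tame_open[OF _ OX] open_Phi_pos[OF P] by (simp add: O'_def)
    next
      case 2
      then show ?thesis using F by (auto intro: tame_countable countable_finite)
    next
      case 3
      obtain p \<theta> where Z: "Z = zero_curve p \<theta>" using 3(1) by (auto simp: \<M>_def \<Z>_def)
      show ?thesis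
        unfolding 3(2) Z
      proof (rule tame_zero_curve_part[OF P F])
        fix q \<phi> assume "(q, \<phi>) \<in> P" "zero_curve q \<phi> \<noteq> zero_curve p \<theta>"
        then have "zero_curve q \<phi> \<in> \<Z> - {Z}" by (auto simp: \<Z>_def Z)
        with 3(1) show "zero_curve p \<theta> \<inter> zero_curve q \<phi> \<subseteq> F"
          unfolding F_def Z by blast
      qed
    qed
  qed
  moreover have "\<Union>\<Y> = ?X"
  proof
    show "\<Union>\<Y> \<subseteq> ?X" using OX by (auto simp: \<Y>_def)
    show "?X \<subseteq> \<Union>\<Y>"
    proof
      fix z assume z: "z \<in> ?X"
      show "z \<in> \<Union>\<Y>"
      proof (cases "z \<in> O'")
        case True
        then show ?thesis by (simp add: \<Y>_def)
      next
        case False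
        then obtain q \<phi> where q: "(q, \<phi>) \<in> P" "\<not> Phi q \<phi> z > 0" by (auto simp: O'_def)
        \<comment> \<open>A point of \<open>X\<close> outside \<open>O'\<close> is a zero of some
          defining function, hence lies on a maximal curve, and \<open>F\<close> settles whether it
          is an exceptional point.\<close>
        with z have "z \<in> zero_curve q \<phi>" by (force simp: mem_zero_curve halfplane_region_def)
        moreover have "zero_curve q \<phi> \<in> \<Z>" using q by (force simp: \<Z>_def)
        then obtain Z where "Z \<in> \<Z>" "zero_curve q \<phi> \<subseteq> Z" "\<forall>Z'\<in>\<Z>. Z \<subseteq> Z' \<longrightarrow> Z = Z'"
          using finite_has_maximal2[OF \<open>finite \<Z>\<close>] by metis
        ultimately have "Z \<in> \<M>" "z \<in> Z" by (auto simp: \<M>_def)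
        with z show ?thesis by (auto simp: \<Y>_def)
      qed
    qed
  qed
  ultimately show ?thesis by simp
qed

theorem theorem3p7:
  fixes H :: "(real \<times> real) set set"
  assumes "finite H" and "H \<noteq> {}"
    and "\<forall>S\<in>H. closed_poly_halfplane S"
  shows "\<exists>C. cell_decomposition (\<Inter>H) C \<and>
           (\<forall>A\<in>\<Inter>H. \<forall>B\<in>\<Inter>H. \<forall>g. shortest_curve (\<Inter>H) A B g \<longrightarrow>
              (\<forall>e\<in>C. interacts_finitely g e))"
proof -
  have "\<forall>S\<in>H. \<exists>x. S = {z. Phi (fst x) (snd x) z \<ge> 0}"
    using assms(3) unfolding closed_poly_halfplane_def by auto
  from bchoice[OF this] obtain f where f: "\<forall>S\<in>H. S = {z. Phi (fst (f S)) (snd (f S)) z \<ge> 0}" ..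
  have "\<Inter>H = halfplane_region (f ` H)"
    unfolding halfplane_region_def using f by (auto simp: case_prod_beta)
  moreover have "tame (halfplane_region (f ` H)) (halfplane_region (f ` H))"
    using assms(1) by (intro tame_halfplane_region) simp
  ultimately have "tame (\<Inter>H) (\<Inter>H)" by simp
  then show ?thesis
    unfolding tame_def by blast
qed

end
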